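(* For any $\boldsymbol\mu,\boldsymbol\lambda$ and $\epsilon_g>0$ such that $(\boldsymbol\mu,\boldsymbol\lambda+2\epsilon_g)\in\mathcal S$, and for any $\epsilon_s\in(0,1)$, under the static-split + Max-Weight rule $\varphi(\boldsymbol\mu,\boldsymbol\lambda+\epsilon_g,\epsilon_s)$: 1. the network cost satisfies $$C^{\varphi(\boldsymbol\mu,\boldsymbol\lambda+\epsilon_g,\epsilon_s)}(\boldsymbol\mu,\boldsymbol\lambda)\le C^{\mathfrak M}(\boldsymbol\mu,\boldsymbol\lambda)+\kappa\,\epsilon_s+\gamma(\epsilon_g)$$ for some constant $\kappa$ that depends on the network size and $\mathsf C_0,\mathsf C_1$, and for some increasing function $\gamma(\cdot)$ with $\lim_{\epsilon_g\to0}\gamma(\epsilon_g)=0$ (neither $\kappa$ nor the function $\gamma$ depends on $\epsilon_s,\epsilon_g$; $\gamma$ may depend on $\boldsymbol\mu,\boldsymbol\lambda$); 2. the network is stable, i.e. $\boldsymbol\lambda\in\Lambda^{\varphi(\boldsymbol\mu,\boldsymbol\lambda+\epsilon_g,\epsilon_s)}(\boldsymbol\mu)$.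
   Context: Model. Time is slotted; there are $n$ users and $M$ base stations (BSs); $\mathcal P_l$ is the set of probability row vectors in $\mathbb R^l$. Packets for user $u$ at BS $m$ arrive as $A_{m,u}(t)\in\{0,\dots,\bar A\}$, with mean $\lambda_{m,u}$; $\boldsymbol\lambda=(\lambda_{m,u})$. The channel state $H(t)$ takes values in a finite set $\mathcal H$ with probability mass function $\boldsymbol\mu$. The pairs $(\mathbf A(t),H(t))$ are i.i.d. over $t\ge1$. For each $h\in\mathcal H$ a finite set $\mathcal R(\mathbf 1,h)\subset\{0,1,\dots,\bar R\}^{M\times n}$ of achievable rate vectors is given. $\mathcal J=\{0,1\}^M$ is the set of activation states. For $j\in\mathcal J$ and $\mathbf r\in\mathbb R^{M\times n}$, $(\mathbf r\circ j)_{m,u}=r_{m,u}$ if $j_m=1$ and $0$ otherwise; $\mathcal R(j,h):=\{\mathbf r\circ j:\mathbf r\in\mathcal R(\mathbf 1,h)\}$, and it is assumed that $\mathcal R(j,h)\subseteq\mathcal R(\mathbf 1,h)$ for all $j,h$. In slot $t$ the scheduler first chooses an activation state $\mathbf J(t)\in\mathcal J$ without knowing $H(t)$, then observes $H(t)|_{\mathbf J(t)}$ (the part of the channel state concerning the active BSs), then chooses a rate vector $\mathbf S(t)\in\mathcal R(\mathbf J(t),H(t))$. Queue lengths (at the beginning of slots) evolve as $Q_{m,u}(t+1)=(Q_{m,u}(t)+A_{m,u}(t)-S_{m,u}(t))^+$. With constants $\mathsf C_0,\mathsf C_1\ge0$, the network cost at time $t$ is $C(t)=\mathsf C_0\|(\mathbf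 J(t-1)-\mathbf J(t))^+\|_1+\mathsf C_1\|\mathbf J(t)\|_1$. Inequalities between vectors are entrywise, and adding a scalar to a vector means adding it to every entry. "Network size" refers to $M$, $n$, $|\mathcal H|$. Policies. A policy is a (possibly randomized) sequence of decisions $(\mathbf J(t),\mathbf S(t))_{t>0}$ where $\mathbf J(t)$ may depend on $\mathcal F_t=(\mathbf A(l),\mathbf J(l),H(l)|_{\mathbf J(l)},\mathbf S(l))_{l=1}^{t-1}$ and $\mathbf S(t)$ on $(\mathcal F_t,\mathbf J(t),H(t)|_{\mathbf J(t)})$. The network state at time $t$ is $(\mathbf J(t-1),\mathbf Q(t))$. The network is stable under a policy $\varphi$ if there are constants $\bar Q,\rho>0$ such that for every initial condition $(\mathbf J(0),\mathbf Q(1))$, $\liminf_{T\to\infty}\frac1T\sum_{t=1}^T\mathbb P_\varphi[\sum_{m,u}Q_{m,u}(t)\le\bar Q\mid\mathbf J(0),\mathbf Q(1)]>\rho$. The support region $\Lambda^\varphi(\boldsymbol\mu)$ is the set of arrival rate vectors for which the network is stable under $\varphi$. The network cost of $\varphi$ is $C^\varphi(\boldsymbol\mu,\boldsymbol\lambda)=\limsup_{T\to\infty}\frac1T\sum_{t=1}^T\mathbb E_\varphi[C(t)\mid\mathbf J(0),\mathbf Q(1)]$. $\mathfrak M$ is the set of ergodic Markov policies: those whose (possibly randomized) decisions at time $t$ depend only on the current state $(\mathbf J(t-1),\mathbf Q(t))$ (and, for rate allocation, on $\mathbf J(t)$ and the observed channel; knowledge of $\boldsymbol\mu,\boldsymbol\lambda$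 is allowed), and for which the network state process is an ergodic Markov chain. $C^{\mathfrak M}(\boldsymbol\mu,\boldsymbol\lambda):=\inf\{C^\varphi(\boldsymbol\mu,\boldsymbol\lambda):\varphi\in\mathfrak M,\ \boldsymbol\lambda\in\Lambda^\varphi(\boldsymbol\mu)\}$. The capacity region is $\Lambda(\boldsymbol\mu)=\bigcup_{\varphi\in\mathfrak M}\Lambda^\varphi(\boldsymbol\mu)$; it is taken as known that $\boldsymbol\lambda\in\Lambda(\boldsymbol\mu)$ iff there are $\boldsymbol\alpha(\mathbf 1,h)\in\mathcal P_{|\mathcal R(\mathbf 1,h)|}$, $h\in\mathcal H$, with $\boldsymbol\lambda<\sum_h\mu(h)\sum_{\mathbf r\in\mathcal R(\mathbf 1,h)}\alpha_{\mathbf r}(\mathbf 1,h)\mathbf r$. $\mathcal S:=\{(\boldsymbol\mu,\boldsymbol\lambda):\boldsymbol\lambda\in\Lambda(\boldsymbol\mu)\}$. Linear program. $L_{\mathbf c}(\boldsymbol\mu,\boldsymbol\lambda)$ is the linear program minimizing $\mathbf c\cdot(\boldsymbol\sigma,\boldsymbol\beta)$ over $\boldsymbol\sigma\in\mathcal P_{|\mathcal J|}$ and $\boldsymbol\beta=(\beta_{j,h,\mathbf r})_{j\in\mathcal J,h\in\mathcal H,\mathbf r\in\mathcal R(j,h)}\ge0$ subject to $\sigma_j=\sum_{\mathbf r\in\mathcal R(j,h)}\beta_{j,h,\mathbf r}$ for all $j,h$, and $\boldsymbol\lambda\le\sum_{j,h,\mathbf r\in\mathcal R(j,h)}\beta_{j,h,\mathbf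 r}\,\mu(h)\,\mathbf r$. Let $\mathbf c^0:=((\mathsf C_1\|j\|_1)_{j\in\mathcal J},\mathbf 0)$. Static-split + Max-Weight rule $\varphi(\boldsymbol\mu,\boldsymbol\lambda+\epsilon_g,\epsilon_s)$. Compute an optimal solution $(\boldsymbol\sigma^*,\boldsymbol\beta^* )$ of $L_{\mathbf c^0}(\boldsymbol\mu,\boldsymbol\lambda+\epsilon_g)$. In every slot, independently, with probability $1-\epsilon_s$ set $\mathbf J(t)=\mathbf J(t-1)$, and with probability $\epsilon_s$ draw $\mathbf J(t)$ from the distribution $\boldsymbol\sigma^*$. Then allocate rates by $\mathbf S(t)\in\arg\max_{\mathbf r\in\mathcal R(\mathbf J(t),H(t))}\mathbf Q(t)\cdot\mathbf r$. *)

theory Defs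
  imports "HOL-Probability.Probability"
begin

section \<open>Network\<close>

text \<open>
  Base stations and users are the elements of the finite types \<open>'m\<close> and \<open>'u\<close>.
  A channel state has one component per base station, \<open>h :: 'm \<Rightarrow> 'c\<close>, where \<open>'c\<close> is arbitrary
  (e.g. a function on users).  An activation state in \<open>{0,1}^M\<close> is the set \<open>j :: 'm set\<close> of its
  active base stations, so \<open>\<one>\<close> is \<open>UNIV\<close>.  The network state at time \<open>t\<close> is the pair
  \<open>(J(t-1), Q(t))\<close>.
\<close>

type_synonym ('m, 'u) vec = "'m \<Rightarrow> 'u \<Rightarrow> nat"
type_synonym ('m, 'u) state = "'m set \<times> ('m, 'u) vec"

record ('m, 'c, 'u) network =
  channels :: "('m \<Rightarrow> 'c) set"
  full_rates :: "('m \<Rightarrow> 'c) \<Rightarrow> ('m, 'u) vec set"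
  max_rate :: nat
  switch_cost :: real
  active_cost :: real

definition mask :: "('m, 'u) vec \<Rightarrow> 'm set \<Rightarrow> ('m, 'u) vec" where
  "mask r j = (\<lambda>m u. if m \<in> j then r m u else 0)"

definition rates :: "('m, 'c, 'u) network \<Rightarrow> 'm set \<Rightarrow> ('m \<Rightarrow> 'c) \<Rightarrow> ('m, 'u) vec set" where
  "rates N j h = (\<lambda>r. mask r j) ` full_rates N h"

definition wf_network :: "('m, 'c, 'u) network \<Rightarrow> bool" where
  "wf_network N \<longleftrightarrow>
     finite (channels N) \<and>
     (\<forall>h\<in>channels N. finite (full_rates N h) \<and> full_rates N h \<noteq> {} \<and>
        (\<forall>r\<in>full_rates N h. \<forall>m u. r m u \<le> max_rate N) \<and>
        (\<forall>j. rates N j h \<subseteq> full_rates N h)) \<and>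
     0 \<le> switch_cost N \<and> 0 \<le> active_cost N"

text \<open>
  The joint law \<open>P\<close> of \<open>(A(t), H(t))\<close> in one slot.  Arrivals and channel state in the same slot
  need not be independent of each other.
\<close>

definition slot_law ::
  "('m, 'c, 'u) network \<Rightarrow> nat \<Rightarrow> ('m \<Rightarrow> 'c) pmf \<Rightarrow> ('m \<Rightarrow> 'u \<Rightarrow> real) \<Rightarrow>
    (('m, 'u) vec \<times> ('m \<Rightarrow> 'c)) pmf \<Rightarrow> bool" where
  "slot_law N Abar \<mu> lam P \<longleftrightarrow>
     (\<forall>(a, h)\<in>set_pmf P. h \<in> channels N \<and> (\<forall>m u. a m u \<le> Abar)) \<and>
     map_pmf snd P = \<mu> \<and>
     (\<forall>m u. measure_pmf.expectation P (\<lambda>(a, h). real (a m u)) = lam m u)"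


section \<open>Markov policies and the network state process\<close>

text \<open>
  A Markov policy draws \<open>J(t)\<close> from \<open>activate \<phi> (J(t-1), Q(t))\<close> and then \<open>S(t)\<close> from
  \<open>allocate \<phi> (J(t-1), Q(t)) J(t) H(t)\<close>.  The type gives the allocation the full channel state;
  that it uses only the part seen by the active base stations is part of \<open>admissible\<close>.
\<close>

record ('m, 'c, 'u) policy =
  activate :: "('m, 'u) state \<Rightarrow> 'm set pmf"
  allocate :: "('m, 'u) state \<Rightarrow> 'm set \<Rightarrow> ('m \<Rightarrow> 'c) \<Rightarrow> ('m, 'u) vec pmf"

definition observe :: "('m \<Rightarrow> 'c) \<Rightarrow> 'm set \<Rightarrow> 'm \<rightharpoonup> 'c" where
  "observe h j = (\<lambda>m. if m \<in> j then Some (h m) else None)"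

definition admissible :: "('m, 'c, 'u) network \<Rightarrow> ('m, 'c, 'u) policy \<Rightarrow> bool" where
  "admissible N \<phi> \<longleftrightarrow>
     (\<forall>s j. \<forall>h\<in>channels N. set_pmf (allocate \<phi> s j h) \<subseteq> rates N j h) \<and>
     (\<forall>s j. \<forall>h\<in>channels N. \<forall>h'\<in>channels N.
        observe h j = observe h' j \<longrightarrow> allocate \<phi> s j h = allocate \<phi> s j h')"

text \<open>Subtraction below is on \<open>nat\<close>, so it truncates at 0 and is the \<open>(\<dots>)\<^sup>+\<close> of the queue recursion.\<close>

definition step ::
  "(('m, 'u) vec \<times> ('m \<Rightarrow> 'c)) pmf \<Rightarrow> ('m, 'c, 'u) policy \<Rightarrow> ('m, 'u) state \<Rightarrow>
    ('m, 'u) state pmf" where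
  "step P \<phi> s = do {
     j \<leftarrow> activate \<phi> s;
     (a, h) \<leftarrow> P;
     r \<leftarrow> allocate \<phi> s j h;
     return_pmf (j, \<lambda>m u. (snd s m u + a m u) - r m u)
   }"

definition iterate_kernel :: "('s \<Rightarrow> 's pmf) \<Rightarrow> nat \<Rightarrow> 's \<Rightarrow> 's pmf" where
  "iterate_kernel K k s = ((\<lambda>p. bind_pmf p K) ^^ k) (return_pmf s)"

text \<open>
  Law of \<open>(J(t-1), Q(t))\<close> for \<open>t \<ge> 1\<close>, given the initial condition \<open>s\<^sub>0 = (J(0), Q(1))\<close>.
\<close>

definition state_at ::
  "(('m, 'u) vec \<times> ('m \<Rightarrow> 'c)) pmf \<Rightarrow> ('m, 'c, 'u) policy \<Rightarrow> ('m, 'u) state \<Rightarrow> nat \<Rightarrow>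
    ('m, 'u) state pmf" where
  "state_at P \<phi> s\<^sub>0 t = iterate_kernel (step P \<phi>) (t - 1) s\<^sub>0"

text \<open>
  Irreducibility on the whole type is not demanded (transient states, e.g. activation states that
  are never chosen, are allowed): there is one invariant probability law, and the chain converges
  to it from every initial state.  For probability laws on a countable set, pointwise convergence
  to a probability law is convergence in total variation.
\<close>

definition ergodic_kernel :: "('s \<Rightarrow> 's pmf) \<Rightarrow> bool" where
  "ergodic_kernel K \<longleftrightarrow>
     (\<exists>\<pi>. bind_pmf \<pi> K = \<pi> \<and>
        (\<forall>x y. (\<lambda>k. pmf (iterate_kernel K k x) y) \<longlonglongrightarrow> pmf \<pi> y))"

definition ergodic_policies ::
  "('m, 'c, 'u) network \<Rightarrow> (('m, 'u) vec \<times> ('m \<Rightarrow> 'c)) pmf \<Rightarrow> ('m, 'c, 'u) policy set" where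
  "ergodic_policies N P = {\<phi>. admissible N \<phi> \<and> ergodic_kernel (step P \<phi>)}"


section \<open>Stability, capacity region and network cost\<close>

definition network_stable ::
  "(('m::finite, 'u::finite) vec \<times> ('m \<Rightarrow> 'c)) pmf \<Rightarrow> ('m, 'c, 'u) policy \<Rightarrow> bool" where
  "network_stable P \<phi> \<longleftrightarrow>
     (\<exists>Qbar > 0 :: real. \<exists>\<rho> > 0 :: real. \<forall>s\<^sub>0.
        liminf (\<lambda>T. ereal (1 / real T *
          (\<Sum>t = 1..T. measure_pmf.prob (state_at P \<phi> s\<^sub>0 t)
             {s. (\<Sum>m\<in>UNIV. \<Sum>u\<in>UNIV. real (snd s m u)) \<le> Qbar}))) > ereal \<rho>)"

text \<open>
  \<open>network_stable P \<phi>\<close> says that the mean arrival rates of \<open>P\<close> lie in the support region of \<open>\<phi>\<close>.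
  A rate vector belongs to the capacity region if some ergodic Markov policy supports it.  The
  arrival bound is left free here: \<open>lam\<close> only has to be the rate of some bounded arrival process.
\<close>

definition capacity_region ::
  "('m::finite, 'c, 'u::finite) network \<Rightarrow> ('m \<Rightarrow> 'c) pmf \<Rightarrow> ('m \<Rightarrow> 'u \<Rightarrow> real) set" where
  "capacity_region N \<mu> =
     {lam. \<exists>Abar P. slot_law N Abar \<mu> lam P \<and> (\<exists>\<phi>\<in>ergodic_policies N P. network_stable P \<phi>)}"

definition supportable ::
  "('m::finite, 'c, 'u::finite) network \<Rightarrow> (('m \<Rightarrow> 'c) pmf \<times> ('m \<Rightarrow> 'u \<Rightarrow> real)) set" where
  "supportable N = {(\<mu>, lam). lam \<in> capacity_region N \<mu>}"

definition slot_cost :: "('m, 'c, 'u) network \<Rightarrow> 'm set \<Rightarrow> 'm set \<Rightarrow> real" where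
  "slot_cost N i j = switch_cost N * real (card (i - j)) + active_cost N * real (card j)"

definition expected_cost ::
  "('m, 'c, 'u) network \<Rightarrow> (('m, 'u) vec \<times> ('m \<Rightarrow> 'c)) pmf \<Rightarrow> ('m, 'c, 'u) policy \<Rightarrow>
    ('m, 'u) state \<Rightarrow> nat \<Rightarrow> real" where
  "expected_cost N P \<phi> s\<^sub>0 t =
     measure_pmf.expectation
       (do { s \<leftarrow> state_at P \<phi> s\<^sub>0 t; j \<leftarrow> activate \<phi> s; return_pmf (fst s, j) })
       (\<lambda>(i, j). slot_cost N i j)"

definition network_cost ::
  "('m, 'c, 'u) network \<Rightarrow> (('m, 'u) vec \<times> ('m \<Rightarrow> 'c)) pmf \<Rightarrow> ('m, 'c, 'u) policy \<Rightarrow>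
    ('m, 'u) state \<Rightarrow> ereal" where
  "network_cost N P \<phi> s\<^sub>0 =
     limsup (\<lambda>T. ereal (1 / real T * (\<Sum>t = 1..T. expected_cost N P \<phi> s\<^sub>0 t)))"

definition optimal_cost ::
  "('m::finite, 'c, 'u::finite) network \<Rightarrow> (('m, 'u) vec \<times> ('m \<Rightarrow> 'c)) pmf \<Rightarrow>
    ('m, 'u) state \<Rightarrow> ereal" where
  "optimal_cost N P s\<^sub>0 =
     (INF \<phi>\<in>{\<phi> \<in> ergodic_policies N P. network_stable P \<phi>}. network_cost N P \<phi> s\<^sub>0)"


section \<open>Linear program\<close>

text \<open>
  Since the set of activation states is finite, probability vectors over it are given as
  \<open>'m set pmf\<close>.  Only the entries \<open>\<beta> j h r\<close> with \<open>h \<in> channels N\<close>, \<open>r \<in> rates N j h\<close> are variables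
  of the program; the others are irrelevant.
\<close>

type_synonym ('m, 'c, 'u) split = "'m set \<Rightarrow> ('m \<Rightarrow> 'c) \<Rightarrow> ('m, 'u) vec \<Rightarrow> real"

definition lp_feasible ::
  "('m::finite, 'c, 'u) network \<Rightarrow> ('m \<Rightarrow> 'c) pmf \<Rightarrow> ('m \<Rightarrow> 'u \<Rightarrow> real) \<Rightarrow>
    'm set pmf \<times> ('m, 'c, 'u) split \<Rightarrow> bool" where
  "lp_feasible N \<mu> lam = (\<lambda>(\<sigma>, \<beta>).
     (\<forall>j. \<forall>h\<in>channels N. \<forall>r\<in>rates N j h. 0 \<le> \<beta> j h r) \<and>
     (\<forall>j. \<forall>h\<in>channels N. pmf \<sigma> j = (\<Sum>r\<in>rates N j h. \<beta> j h r)) \<and>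
     (\<forall>m u. lam m u \<le>
        (\<Sum>j\<in>UNIV. \<Sum>h\<in>channels N. \<Sum>r\<in>rates N j h. \<beta> j h r * pmf \<mu> h * real (r m u))))"

definition lp_objective ::
  "('m::finite, 'c, 'u) network \<Rightarrow> ('m set \<Rightarrow> real) \<times> ('m, 'c, 'u) split \<Rightarrow>
    'm set pmf \<times> ('m, 'c, 'u) split \<Rightarrow> real" where
  "lp_objective N = (\<lambda>(c\<^sub>\<sigma>, c\<^sub>\<beta>) (\<sigma>, \<beta>).
     (\<Sum>j\<in>UNIV. c\<^sub>\<sigma> j * pmf \<sigma> j) +
     (\<Sum>j\<in>UNIV. \<Sum>h\<in>channels N. \<Sum>r\<in>rates N j h. c\<^sub>\<beta> j h r * \<beta> j h r))"

definition lp_optimal ::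
  "('m::finite, 'c, 'u) network \<Rightarrow> ('m set \<Rightarrow> real) \<times> ('m, 'c, 'u) split \<Rightarrow>
    ('m \<Rightarrow> 'c) pmf \<Rightarrow> ('m \<Rightarrow> 'u \<Rightarrow> real) \<Rightarrow> 'm set pmf \<times> ('m, 'c, 'u) split \<Rightarrow> bool" where
  "lp_optimal N c \<mu> lam = is_arg_min (lp_objective N c) (lp_feasible N \<mu> lam)"

definition activation_objective ::
  "('m, 'c, 'u) network \<Rightarrow> ('m set \<Rightarrow> real) \<times> ('m, 'c, 'u) split" where
  "activation_objective N = (\<lambda>j. active_cost N * real (card j), \<lambda>_ _ _. 0)"


section \<open>Static-split and Max-Weight\<close>

definition weight :: "('m::finite, 'u::finite) vec \<Rightarrow> ('m, 'u) vec \<Rightarrow> nat" where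
  "weight q r = (\<Sum>m\<in>UNIV. \<Sum>u\<in>UNIV. q m u * r m u)"

text \<open>
  \<open>\<phi>\<close> is an instance of the rule with parameters \<open>(\<mu>, lam, \<epsilon>\<^sub>s)\<close>, for some choice of the optimal
  solution of the linear program and some (possibly randomized) way of breaking ties in the
  Max-Weight allocation.
\<close>

definition static_split_max_weight ::
  "('m::finite, 'c, 'u::finite) network \<Rightarrow> ('m \<Rightarrow> 'c) pmf \<Rightarrow> ('m \<Rightarrow> 'u \<Rightarrow> real) \<Rightarrow> real \<Rightarrow>
    ('m, 'c, 'u) policy \<Rightarrow> bool" where
  "static_split_max_weight N \<mu> lam \<epsilon>\<^sub>s \<phi> \<longleftrightarrow>
     (\<exists>\<sigma> \<beta>. lp_optimal N (activation_objective N) \<mu> lam (\<sigma>, \<beta>) \<and>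
        (\<forall>i q. activate \<phi> (i, q) =
           do { b \<leftarrow> bernoulli_pmf \<epsilon>\<^sub>s; if b then \<sigma> else return_pmf i })) \<and>
     (\<forall>i q j. \<forall>h\<in>channels N. \<forall>r\<in>set_pmf (allocate \<phi> (i, q) j h).
        is_arg_max (weight q) (\<lambda>r. r \<in> rates N j h) r)"

end

theory Submission
  imports Defs
begin

text \<open>
  An invariant law of an ergodic policy yields a feasible point of the program at \<open>lam\<close> whose
  objective is at most the network cost, by averaging the decisions of the policy.  As the optimal
  value is convex and bounded, raising \<open>lam\<close> by \<open>\<epsilon>\<^sub>g\<close> raises it at most linearly in \<open>\<epsilon>\<^sub>g\<close>.  Under
  static split the activation state is a lazy chain with limit law \<open>\<sigma>\<close>; it switches with probability
  at most \<open>\<epsilon>\<^sub>s\<close> per slot, so its cost is at most the optimal value plus \<open>switch_cost * M * \<epsilon>\<^sub>s\<close>.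
  Stability follows from a quadratic Lyapunov function corrected for the slow activation chain.
\<close>

section \<open>Expectations over discrete laws\<close>

text \<open>The two policies are compared only through the program: every ergodic policy costs at
  least the objective of some feasible point at \<open>lam\<close>, while the rule costs at most its
  own optimum at \<open>lam + \<epsilon>\<^sub>g\<close> plus switching. The queues of the rule do
  not enter its cost, since its activation ignores them. Two obstacles shape the rest. Ergodicity
  gives convergence of point probabilities only, and the invariant law may have infinite support;
  expectations are therefore split into a finite set and a small tail. Moreover, the activation
  state stays frozen for about \<open>1 / \<epsilon>\<^sub>s\<close> slots, during which queues may
  grow although the average over \<open>\<sigma>\<close> would serve them. The plain quadratic
  function then lacks a negative one-slot drift, and the correction restores it without passing to
  drifts over long blocks. As the correction grows only linearly in the queues, the quadratic part
  dominates and the corrected function is bounded below. Summing its drift and applying Markov's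
  inequality gives the occupation bound.\<close>

lemma expectation_bind_finite:
  fixes h :: "'b \<Rightarrow> real"
  assumes "finite (set_pmf p)" "\<And>x. x \<in> set_pmf p \<Longrightarrow> finite (set_pmf (f x))"
  shows "measure_pmf.expectation (bind_pmf p f) h =
         measure_pmf.expectation p (\<lambda>x. measure_pmf.expectation (f x) h)"
  using assms
  by (subst pmf_expectation_bind[of "set_pmf p"])
     (auto simp: integral_measure_pmf[of "set_pmf p"])

text \<open>For invariant laws, whose support may be infinite. The identity is unconditional for
  nonnegative integrals, and boundedness brings it back to real ones.\<close>

lemma expectation_bind_bounded:
  fixes h :: "'b \<Rightarrow> real"
  assumes "\<And>y. 0 \<le> h y" "\<And>y. h y \<le> B"
  shows "measure_pmf.expectation (bind_pmf p f) h =
         measure_pmf.expectation p (\<lambda>x. measure_pmf.expectation (f x) h)"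
proof -
  have int: "integrable (measure_pmf q) h" for q
    by (rule measure_pmf.integrable_const_bound[where B = B]) (use assms in auto)
  have bounds: "0 \<le> measure_pmf.expectation q h" "measure_pmf.expectation q h \<le> B" for q
  proof -
    show "0 \<le> measure_pmf.expectation q h"
      using assms(1) by simp
    show "measure_pmf.expectation q h \<le> B"
      using measure_pmf.integral_le_const[OF int] assms(2) by simp
  qed
  have int': "integrable (measure_pmf p) (\<lambda>x. measure_pmf.expectation (f x) h)"
    by (rule measure_pmf.integrable_const_bound[where B = B]) (use bounds in auto)
  have "ennreal (measure_pmf.expectation (bind_pmf p f) h) =
        ennreal (measure_pmf.expectation p (\<lambda>x. measure_pmf.expectation (f x) h))"
    by (simp add: nn_integral_eq_integral[symmetric] int int' assms bounds)
  then show ?thesis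
    using bounds by (simp add: integral_nonneg_AE)
qed

lemma expectation_mono_pmf:
  fixes f g :: "'a \<Rightarrow> real"
  assumes "finite (set_pmf p)" "\<And>x. x \<in> set_pmf p \<Longrightarrow> f x \<le> g x"
  shows "measure_pmf.expectation p f \<le> measure_pmf.expectation p g"
  using assms by (intro integral_mono_AE) (auto simp: integrable_measure_pmf_finite AE_measure_pmf_iff)

lemma expectation_cong_pmf:
  fixes f g :: "'a \<Rightarrow> real"
  assumes "\<And>x. x \<in> set_pmf p \<Longrightarrow> f x = g x"
  shows "measure_pmf.expectation p f = measure_pmf.expectation p g"
  using assms by (intro integral_cong_AE) (auto simp: AE_measure_pmf_iff)

lemma expectation_finite_type:
  fixes f :: "'a::finite \<Rightarrow> real"
  shows "measure_pmf.expectation p f = (\<Sum>j\<in>UNIV. pmf p j * f j)"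
  by (subst integral_measure_pmf[of UNIV]) auto

lemma expectation_static_split:
  fixes f :: "'a \<Rightarrow> real"
  assumes "0 \<le> \<epsilon>" "\<epsilon> \<le> 1" "finite (set_pmf \<sigma>)"
  shows "measure_pmf.expectation (do { b \<leftarrow> bernoulli_pmf \<epsilon>; if b then \<sigma> else return_pmf i }) f =
    \<epsilon> * measure_pmf.expectation \<sigma> f + (1 - \<epsilon>) * f i"
  using assms by (subst expectation_bind_finite) (auto simp: mult_ac)

text \<open>The points of mass at least \<open>1 / (n + 1)\<close> form a finite set, as
  \<open>n + 2\<close> of them would carry more than total mass 1, and these sets increase to a
  superset of the support.\<close>

lemma pmf_finite_tail:
  assumes "0 < (e :: real)"
  shows "\<exists>F. finite F \<and> measure_pmf.prob p (- F) < e"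
proof -
  define A where "A n = {x. 1 / real (Suc n) \<le> pmf p x}" for n
  have fin: "finite (A n)" for n
  proof (rule ccontr)
    assume "infinite (A n)"
    then obtain B where B: "B \<subseteq> A n" "finite B" "card B = n + 2"
      by (meson infinite_arbitrarily_large)
    have "real (card B) * (1 / real (Suc n)) \<le> (\<Sum>x\<in>B. pmf p x)"
      using B(1) by (intro sum_bounded_below) (auto simp: A_def)
    also have "\<dots> = measure_pmf.prob p B"
      using B(2) by (simp add: measure_measure_pmf_finite)
    also have "\<dots> \<le> 1" by simp
    finally show False using B(3) by (simp add: field_simps)
  qed
  have "(\<lambda>n. measure_pmf.prob p (A n)) \<longlonglongrightarrow> measure_pmf.prob p (\<Union>n. A n)"
  proof (rule measure_pmf.finite_Lim_measure_incseq)
    show "incseq A"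
      unfolding A_def incseq_def
    proof safe
      fix m n :: nat and x assume "m \<le> n" and x: "1 / real (Suc m) \<le> pmf p x"
      from \<open>m \<le> n\<close> have "1 / real (Suc n) \<le> 1 / real (Suc m)" by (simp add: frac_le)
      with x show "1 / real (Suc n) \<le> pmf p x" by simp
    qed
  qed auto
  moreover have "set_pmf p \<subseteq> (\<Union>n. A n)"
  proof
    fix x assume "x \<in> set_pmf p"
    then have "0 < pmf p x" by (rule pmf_positive)
    then obtain n where "inverse (real (Suc n)) < pmf p x" using reals_Archimedean by blast
    then show "x \<in> (\<Union>n. A n)" by (auto simp: A_def inverse_eq_divide intro!: exI[of _ n])
  qed
  then have "measure_pmf.prob p (\<Union>n. A n) = 1"
    by (subst measure_pmf.prob_eq_1) (auto simp: AE_measure_pmf_iff)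
  ultimately have "(\<lambda>n. measure_pmf.prob p (A n)) \<longlonglongrightarrow> 1" by simp
  from order_tendstoD(1)[OF this, of "1 - e"] assms
  obtain n where "1 - e < measure_pmf.prob p (A n)"
    by (auto simp: eventually_sequentially)
  then have "measure_pmf.prob p (- A n) < e"
    using measure_pmf.prob_compl[of "A n" p] by (simp add: Compl_eq_Diff_UNIV)
  with fin show ?thesis by blast
qed

lemma integrable_bounded_pmf:
  fixes f :: "'s \<Rightarrow> real"
  assumes "\<And>x. \<bar>f x\<bar> \<le> B"
  shows "integrable (measure_pmf p) f"
  by (rule measure_pmf.integrable_const_bound[where B = B]) (use assms in auto)

text \<open>Convergence of point probabilities passes to the limit in sums over a finite
  \<open>F\<close>. This bound controls what \<open>F\<close> misses under the limit law;
  \<open>finite_part_le_expectation\<close> is the counterpart for the laws along the chain.\<close>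

lemma expectation_le_finite_part:
  fixes f :: "'a \<Rightarrow> real"
  assumes "finite F" "\<And>x. 0 \<le> f x" "\<And>x. f x \<le> B"
  shows "measure_pmf.expectation p f \<le> (\<Sum>x\<in>F. pmf p x * f x) + B * measure_pmf.prob p (- F)"
proof -
  have int: "integrable (measure_pmf p) f"
    by (rule measure_pmf.integrable_const_bound[where B = B]) (use assms in auto)
  have int1: "integrable (measure_pmf p) (\<lambda>x. f x * indicator F x)"
    by (rule integrable_real_mult_indicator) (auto intro: int)
  have int2: "integrable (measure_pmf p) (\<lambda>x. B * indicator (- F) x)"
    by (rule integrable_bounded_pmf[where B = "\<bar>B\<bar>"]) (simp add: indicator_def)
  have "measure_pmf.expectation p f \<le>
        measure_pmf.expectation p (\<lambda>x. f x * indicator F x + B * indicator (- F) x)"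
    using assms by (intro integral_mono int int1 int2 Bochner_Integration.integrable_add)
      (auto simp: indicator_def)
  also have "\<dots> = measure_pmf.expectation p (\<lambda>x. f x * indicator F x) + B * measure_pmf.prob p (- F)"
    by (simp add: Bochner_Integration.integral_add[OF int1 int2])
  also have "measure_pmf.expectation p (\<lambda>x. f x * indicator F x) = (\<Sum>x\<in>F. pmf p x * f x)"
    using assms(1) by (subst integral_measure_pmf[of F]) (auto simp: indicator_def)
  finally show ?thesis .
qed

lemma finite_part_le_expectation:
  fixes f :: "'a \<Rightarrow> real"
  assumes "finite F" "\<And>x. 0 \<le> f x" "integrable (measure_pmf p) f"
  shows "(\<Sum>x\<in>F. pmf p x * f x) \<le> measure_pmf.expectation p f"
proof -
  have "(\<Sum>x\<in>F. pmf p x * f x) = measure_pmf.expectation p (\<lambda>x. f x * indicator F x)"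
    using assms(1) by (subst integral_measure_pmf[of F]) (auto simp: indicator_def)
  also have "\<dots> \<le> measure_pmf.expectation p f"
    using assms by (intro integral_mono integrable_real_mult_indicator) (auto simp: indicator_def)
  finally show ?thesis .
qed

lemma cesaro_mean_LIMSEQ:
  fixes x :: "nat \<Rightarrow> real"
  assumes "x \<longlonglongrightarrow> L"
  shows "(\<lambda>T. 1 / real T * (\<Sum>k<T. x k)) \<longlonglongrightarrow> L"
proof (rule LIMSEQ_I)
  fix e :: real assume e: "0 < e"
  obtain n where n: "\<And>k. n \<le> k \<Longrightarrow> \<bar>x k - L\<bar> < e / 2"
    using LIMSEQ_D[OF assms, of "e / 2"] e by auto
  define D where "D = (\<Sum>k<n. \<bar>x k - L\<bar>)"
  have D: "0 \<le> D" by (simp add: D_def sum_nonneg)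
  obtain T0 :: nat where T0: "2 * D / e < real T0" using reals_Archimedean2 by blast
  show "\<exists>no. \<forall>T\<ge>no. norm (1 / real T * (\<Sum>k<T. x k) - L) < e"
  proof (intro exI allI impI)
    fix T assume T: "max (Suc n) T0 \<le> T"
    then have "0 < T" by simp
    have "\<bar>\<Sum>k<T. x k - L\<bar> \<le> (\<Sum>k<T. \<bar>x k - L\<bar>)" by (rule sum_abs)
    also have "\<dots> = D + (\<Sum>k=n..<T. \<bar>x k - L\<bar>)"
      using T by (simp add: D_def lessThan_atLeast0 sum.atLeastLessThan_concat)
    also have "(\<Sum>k=n..<T. \<bar>x k - L\<bar>) \<le> real (card {n..<T}) * (e / 2)"
      by (rule sum_bounded_above) (use n in \<open>auto simp: less_imp_le\<close>)
    also have "\<dots> \<le> real T * (e / 2)" using e by (intro mult_right_mono) auto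
    finally have "\<bar>\<Sum>k<T. x k - L\<bar> \<le> D + real T * (e / 2)" by simp
    also have "D < real T * (e / 2)"
    proof -
      have "2 * D / e < real T" using T T0 by linarith
      then show ?thesis using e by (simp add: field_simps)
    qed
    finally have *: "\<bar>\<Sum>k<T. x k - L\<bar> < real T * e" by linarith
    have "1 / real T * (\<Sum>k<T. x k) - L = (\<Sum>k<T. x k - L) / real T"
      using \<open>0 < T\<close> by (simp add: sum_subtractf field_simps)
    then show "norm (1 / real T * (\<Sum>k<T. x k) - L) < e"
      using * \<open>0 < T\<close> by (simp add: field_simps)
  qed
qed


section \<open>Iterated kernels\<close>

lemma iterate_kernel_0 [simp]: "iterate_kernel K 0 s = return_pmf s"
  by (simp add: iterate_kernel_def)

lemma iterate_kernel_Suc: "iterate_kernel K (Suc k) s = bind_pmf (iterate_kernel K k s) K"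
  by (simp add: iterate_kernel_def)

lemma finite_set_pmf_iterate_kernel:
  assumes "\<And>s. finite (set_pmf (K s))"
  shows "finite (set_pmf (iterate_kernel K k s))"
  by (induction k) (auto simp: iterate_kernel_Suc assms)

text \<open>The drift inequality telescopes. \<open>V\<close> may be unbounded and negative:
  finitely supported transitions keep its expectations finite, and \<open>C\<close> accommodates a
  corrected Lyapunov function that is only bounded below.\<close>

lemma foster_lyapunov_time_average:
  fixes V f :: "'s \<Rightarrow> real"
  assumes fin: "\<And>s. finite (set_pmf (K s))"
    and drift: "\<And>s. measure_pmf.expectation (K s) V \<le> V s - f s + B"
    and below: "\<And>s. - C \<le> V s"
  shows "(\<Sum>k<T. measure_pmf.expectation (iterate_kernel K k s) f) \<le> V s + C + B * real T"
proof -
  note int = integrable_measure_pmf_finite[OF finite_set_pmf_iterate_kernel[of K, OF fin]]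
  have "measure_pmf.expectation (iterate_kernel K T s) V +
        (\<Sum>k<T. measure_pmf.expectation (iterate_kernel K k s) f) \<le> V s + B * real T"
  proof (induction T)
    case (Suc T)
    let ?p = "iterate_kernel K T s"
    have "measure_pmf.expectation (iterate_kernel K (Suc T) s) V =
          measure_pmf.expectation ?p (\<lambda>x. measure_pmf.expectation (K x) V)"
      unfolding iterate_kernel_Suc
      by (rule expectation_bind_finite) (auto simp: fin finite_set_pmf_iterate_kernel)
    also have "\<dots> \<le> measure_pmf.expectation ?p (\<lambda>x. V x - f x + B)"
      by (intro integral_mono int drift)
    also have "\<dots> = measure_pmf.expectation ?p V - measure_pmf.expectation ?p f + B"
      by (simp add: int)
    finally show ?case using Suc by (simp add: algebra_simps)
  qed simp
  moreover have "- C \<le> measure_pmf.expectation (iterate_kernel K T s) V"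
    by (intro measure_pmf.integral_ge_const int) (simp add: below)
  ultimately show ?thesis by linarith
qed

text \<open>The time average of the mean of \<open>f\<close> is asymptotically at most
  \<open>B\<close>, so by Markov's inequality at level \<open>2 * B\<close> at least half of the
  mass stays below. The initial state enters only through \<open>?X / real T\<close>, which
  vanishes; this gives the uniformity over initial conditions that stability asks for.\<close>

lemma foster_lyapunov_occupation:
  fixes V f :: "'s \<Rightarrow> real"
  assumes fin: "\<And>s. finite (set_pmf (K s))"
    and drift: "\<And>s. measure_pmf.expectation (K s) V \<le> V s - f s + B"
    and below: "\<And>s. - C \<le> V s" and f: "\<And>s. 0 \<le> f s" and B: "0 < B"
  shows "1 / 2 \<le> liminf (\<lambda>T. ereal (1 / real T *
    (\<Sum>k<T. measure_pmf.prob (iterate_kernel K k s) {s. f s \<le> 2 * B})))"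
proof -
  let ?p = "\<lambda>k. measure_pmf.prob (iterate_kernel K k s) {s. f s \<le> 2 * B}"
  let ?X = "(V s + C) / (2 * B)"
  have lower: "1 / 2 - ?X / real T \<le> 1 / real T * (\<Sum>k<T. ?p k)" if T: "0 < T" for T
  proof -
    have markov: "1 - measure_pmf.expectation (iterate_kernel K k s) f / (2 * B) \<le> ?p k" for k
    proof -
      let ?q = "iterate_kernel K k s"
      note int = integrable_measure_pmf_finite[OF finite_set_pmf_iterate_kernel[of K, OF fin]]
      have "measure_pmf.expectation ?q (\<lambda>x. 1 - f x / (2 * B)) \<le>
          measure_pmf.expectation ?q (indicator {s. f s \<le> 2 * B})"
        using B f by (intro integral_mono int) (auto simp: indicator_def field_simps)
      then show ?thesis by (simp add: int)
    qed
    have "(\<Sum>k<T. measure_pmf.expectation (iterate_kernel K k s) f) / (2 * B) \<le>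
        (V s + C + B * real T) / (2 * B)"
      using B by (intro divide_right_mono foster_lyapunov_time_average[OF fin drift below]) auto
    moreover have "real T - (\<Sum>k<T. measure_pmf.expectation (iterate_kernel K k s) f) / (2 * B) \<le> (\<Sum>k<T. ?p k)"
      using sum_mono[of "{..<T}", OF markov] by (simp add: sum_subtractf sum_divide_distrib)
    ultimately have "real T / 2 - ?X \<le> (\<Sum>k<T. ?p k)"
      using B by (simp add: add_divide_distrib)
    then have "1 / real T * (real T / 2 - ?X) \<le> 1 / real T * (\<Sum>k<T. ?p k)"
      by (intro mult_left_mono) auto
    moreover have "1 / real T * (real T / 2 - ?X) = 1 / 2 - ?X / real T"
      using T by (simp add: right_diff_distrib)
    ultimately show ?thesis by simp
  qed
  have "(\<lambda>T. 1 / 2 - ?X / real T) \<longlonglongrightarrow> 1 / 2 - 0"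
    by (intro tendsto_intros lim_const_over_n)
  then have "liminf (\<lambda>T. ereal (1 / 2 - ?X / real T)) = ereal (1 / 2)"
    by (intro lim_imp_Liminf) auto
  moreover have "liminf (\<lambda>T. ereal (1 / 2 - ?X / real T)) \<le>
      liminf (\<lambda>T. ereal (1 / real T * (\<Sum>k<T. ?p k)))"
    by (intro Liminf_mono eventually_mono[OF eventually_gt_at_top[of 0]]) (simp only: ereal_less_eq lower)
  ultimately show ?thesis by (simp add: numeral_eq_ereal one_ereal_def)
qed


section \<open>The network in one slot\<close>

lemma sum_weighted_swap:
  fixes q :: "'a \<Rightarrow> 'b \<Rightarrow> real"
  shows "(\<Sum>m\<in>A. \<Sum>u\<in>B. q m u * (\<Sum>x\<in>X. f x m u)) = (\<Sum>x\<in>X. \<Sum>m\<in>A. \<Sum>u\<in>B. q m u * f x m u)"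
  unfolding sum_distrib_left by (subst sum.swap[of _ X B], subst sum.swap[of _ X A], rule refl)

text \<open>Truncation at 0 can only shrink the square of the real difference; expanding that square
  leaves \<open>(a - r)^2\<close>, bounded by \<open>(A + R)^2\<close>.\<close>

lemma queue_square_le:
  fixes q a r R A :: nat
  assumes "a \<le> A" "r \<le> R"
  shows "(real ((q + a) - r))\<^sup>2 \<le> (real q)\<^sup>2 + 2 * (real q * real a) - 2 * (real q * real r) + (real (A + R))\<^sup>2"
proof -
  have "(real ((q + a) - r))\<^sup>2 \<le> (real q + real a - real r)\<^sup>2"
    by (cases "r \<le> q + a") (auto simp: of_nat_diff)
  also have "\<dots> = (real q)\<^sup>2 + 2 * (real q * real a) - 2 * (real q * real r) + (real a - real r)\<^sup>2"
    by (simp add: power2_eq_square algebra_simps)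
  also have "(real a - real r)\<^sup>2 \<le> (real (A + R))\<^sup>2"
    using assms by (intro abs_le_square_iff[THEN iffD1]) auto
  finally show ?thesis by simp
qed

locale slotted_network =
  fixes N :: "('m::finite, 'c, 'u::finite) network"
    and Abar :: nat and \<mu> :: "('m \<Rightarrow> 'c) pmf" and lam :: "'m \<Rightarrow> 'u \<Rightarrow> real"
    and P :: "(('m, 'u) vec \<times> ('m \<Rightarrow> 'c)) pmf"
  assumes wf: "wf_network N" and law: "slot_law N Abar \<mu> lam P"
begin

lemma finite_channels: "finite (channels N)"
  using wf by (simp add: wf_network_def)

lemma finite_rates: "h \<in> channels N \<Longrightarrow> finite (rates N j h)"
  using wf by (simp add: wf_network_def rates_def)

lemma rates_nonempty: "h \<in> channels N \<Longrightarrow> rates N j h \<noteq> {}"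
  using wf by (simp add: wf_network_def rates_def)

lemma rates_le: "h \<in> channels N \<Longrightarrow> r \<in> rates N j h \<Longrightarrow> r m u \<le> max_rate N"
  using wf by (meson wf_network_def subsetD)

lemma switch_cost_nonneg: "0 \<le> switch_cost N" and active_cost_nonneg: "0 \<le> active_cost N"
  using wf by (simp_all add: wf_network_def)

lemma slot_channel: "(a, h) \<in> set_pmf P \<Longrightarrow> h \<in> channels N"
  and slot_arrival_le: "(a, h) \<in> set_pmf P \<Longrightarrow> a m u \<le> Abar"
  using law by (auto simp: slot_law_def)

lemma channel_law: "map_pmf snd P = \<mu>"
  and mean_arrival: "measure_pmf.expectation P (\<lambda>(a, h). real (a m u)) = lam m u"
  using law by (auto simp: slot_law_def)

lemma set_pmf_channel: "set_pmf \<mu> \<subseteq> channels N"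
  using slot_channel by (auto simp flip: channel_law)

text \<open>The state space is infinite, but bounded arrivals and finitely many channels make each
  transition finitely supported, so integrability is automatic along the chain.\<close>

lemma finite_slot: "finite (set_pmf P)"
proof -
  have "finite {a :: ('m, 'u) vec. \<forall>m u. a m u \<le> Abar}"
  proof -
    have "finite {b :: 'u \<Rightarrow> nat. \<forall>u. b u \<in> {..Abar}}"
      using finite_set_of_finite_funs[of "UNIV :: 'u set" "{..Abar}" 0] by simp
    then have "finite {a :: ('m, 'u) vec. \<forall>m. a m \<in> {b. \<forall>u. b u \<in> {..Abar}}}"
      using finite_set_of_finite_funs[of "UNIV :: 'm set" "{b :: 'u \<Rightarrow> nat. \<forall>u. b u \<in> {..Abar}}" "\<lambda>_. 0"]
      by simp
    then show ?thesis by simp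
  qed
  moreover have "set_pmf P \<subseteq> {a. \<forall>m u. a m u \<le> Abar} \<times> channels N"
    using slot_channel slot_arrival_le by auto
  ultimately show ?thesis
    using finite_channels by (meson finite_SigmaI finite_subset)
qed

lemma sum_pmf_channel: "(\<Sum>h\<in>channels N. pmf \<mu> h) = 1"
  by (rule sum_pmf_eq_1[OF finite_channels set_pmf_channel])

lemma expectation_channel:
  fixes g :: "('m \<Rightarrow> 'c) \<Rightarrow> real"
  shows "measure_pmf.expectation P (\<lambda>(a, h). g h) = (\<Sum>h\<in>channels N. pmf \<mu> h * g h)"
proof -
  have "measure_pmf.expectation P (\<lambda>(a, h). g h) = measure_pmf.expectation \<mu> g"
    by (subst channel_law[symmetric]) (simp add: case_prod_unfold)
  also have "\<dots> = (\<Sum>h\<in>channels N. pmf \<mu> h * g h)"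
    using finite_channels set_pmf_channel by (subst integral_measure_pmf[of "channels N"]) auto
  finally show ?thesis .
qed

lemma integrable_slot: "integrable (measure_pmf P) (f :: _ \<Rightarrow> real)"
  by (rule integrable_measure_pmf_finite[OF finite_slot])

text \<open>Shared by the ergodic policies, through \<open>admissible\<close>, and by the rule,
  through \<open>is_arg_max\<close>; the same transition lemmas then serve both sides of the
  comparison.\<close>

definition feasible_rates :: "('m, 'c, 'u) policy \<Rightarrow> bool" where
  "feasible_rates \<phi> \<longleftrightarrow> (\<forall>s j. \<forall>h\<in>channels N. set_pmf (allocate \<phi> s j h) \<subseteq> rates N j h)"

lemma set_pmf_allocate:
  "feasible_rates \<phi> \<Longrightarrow> h \<in> channels N \<Longrightarrow> set_pmf (allocate \<phi> s j h) \<subseteq> rates N j h"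
  unfolding feasible_rates_def by blast

lemma finite_set_pmf_allocate:
  "feasible_rates \<phi> \<Longrightarrow> h \<in> channels N \<Longrightarrow> finite (set_pmf (allocate \<phi> s j h))"
  by (meson set_pmf_allocate finite_rates finite_subset)

lemma sum_pmf_allocate:
  "feasible_rates \<phi> \<Longrightarrow> h \<in> channels N \<Longrightarrow> (\<Sum>r\<in>rates N j h. pmf (allocate \<phi> s j h) r) = 1"
  by (meson set_pmf_allocate finite_rates sum_pmf_eq_1)

lemma expectation_allocate:
  fixes f :: "('m, 'u) vec \<Rightarrow> real"
  assumes "feasible_rates \<phi>" "h \<in> channels N"
  shows "measure_pmf.expectation (allocate \<phi> s j h) f =
         (\<Sum>r\<in>rates N j h. pmf (allocate \<phi> s j h) r * f r)"
  using assms finite_rates set_pmf_allocate[of \<phi> h s j]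
  by (subst integral_measure_pmf[of "rates N j h"]) auto

section \<open>Expectation over one transition\<close>

lemma finite_set_pmf_step:
  assumes "feasible_rates \<phi>"
  shows "finite (set_pmf (step P \<phi> s))"
  unfolding step_def using finite_slot finite_set_pmf_allocate[OF assms, of _ s] slot_channel
  by (auto simp: case_prod_unfold)

lemma expectation_step:
  fixes f :: "('m, 'u) state \<Rightarrow> real"
  assumes \<phi>: "feasible_rates \<phi>"
  shows "measure_pmf.expectation (step P \<phi> s) f =
    measure_pmf.expectation (activate \<phi> s) (\<lambda>j. measure_pmf.expectation P (\<lambda>(a, h).
      measure_pmf.expectation (allocate \<phi> s j h) (\<lambda>r. f (j, \<lambda>m u. (snd s m u + a m u) - r m u))))"
proof -
  define R where "R j a h = bind_pmf (allocate \<phi> s j h)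
    (\<lambda>r. return_pmf (j, \<lambda>m u. (snd s m u + a m u) - r m u))" for j a h
  have finR: "finite (set_pmf (R j a h))" if "(a, h) \<in> set_pmf P" for j a h
    using finite_set_pmf_allocate[OF \<phi>] slot_channel[OF that] by (simp add: R_def)
  have R: "measure_pmf.expectation (R j a h) f =
    measure_pmf.expectation (allocate \<phi> s j h) (\<lambda>r. f (j, \<lambda>m u. (snd s m u + a m u) - r m u))"
    if "(a, h) \<in> set_pmf P" for j a h
    unfolding R_def using finite_set_pmf_allocate[OF \<phi>] slot_channel[OF that]
    by (subst expectation_bind_finite) auto
  have "step P \<phi> s = bind_pmf (activate \<phi> s) (\<lambda>j. bind_pmf P (\<lambda>(a, h). R j a h))"
    by (simp add: step_def R_def)
  then have "measure_pmf.expectation (step P \<phi> s) f = measure_pmf.expectation (activate \<phi> s)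
      (\<lambda>j. measure_pmf.expectation (bind_pmf P (\<lambda>(a, h). R j a h)) f)"
    using finite_slot finR by (simp add: expectation_bind_finite case_prod_unfold)
  also have "\<dots> = measure_pmf.expectation (activate \<phi> s)
      (\<lambda>j. measure_pmf.expectation P (\<lambda>(a, h). measure_pmf.expectation (R j a h) f))"
    using finite_slot finR by (simp add: expectation_bind_finite case_prod_unfold)
  also have "\<dots> = measure_pmf.expectation (activate \<phi> s) (\<lambda>j. measure_pmf.expectation P (\<lambda>(a, h).
      measure_pmf.expectation (allocate \<phi> s j h) (\<lambda>r. f (j, \<lambda>m u. (snd s m u + a m u) - r m u))))"
    by (intro expectation_cong_pmf) (auto simp: R)
  finally show ?thesis .
qed

text \<open>Drift inequalities are checked outcome by outcome, and only on outcomes of positive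
  probability, where the arrival bound and the Max-Weight property are available.\<close>

lemma expectation_step_le:
  fixes f :: "('m, 'u) state \<Rightarrow> real" and g :: "'m set \<Rightarrow> ('m, 'u) vec \<Rightarrow> ('m \<Rightarrow> 'c) \<Rightarrow> ('m, 'u) vec \<Rightarrow> real"
  assumes \<phi>: "feasible_rates \<phi>"
    and le: "\<And>j a h r. (a, h) \<in> set_pmf P \<Longrightarrow> r \<in> set_pmf (allocate \<phi> s j h) \<Longrightarrow>
      f (j, \<lambda>m u. (snd s m u + a m u) - r m u) \<le> g j a h r"
  shows "measure_pmf.expectation (step P \<phi> s) f \<le>
    measure_pmf.expectation (activate \<phi> s) (\<lambda>j. measure_pmf.expectation P (\<lambda>(a, h).
      measure_pmf.expectation (allocate \<phi> s j h) (g j a h)))"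
  unfolding expectation_step[OF \<phi>]
  using finite_slot finite_set_pmf_allocate[OF \<phi>, of _ s] slot_channel le
  by (intro expectation_mono_pmf) (auto intro!: expectation_mono_pmf)

section \<open>Ergodic policies and the linear program\<close>

text \<open>Offered service, which may exceed the queue. The form is that of the capacity constraint
  of the program: integrating over states turns the product of the first two factors into
  \<beta>.\<close>

definition mean_service :: "('m, 'c, 'u) policy \<Rightarrow> ('m, 'u) state \<Rightarrow> 'm \<Rightarrow> 'u \<Rightarrow> real" where
  "mean_service \<phi> s m u = (\<Sum>j\<in>UNIV. \<Sum>h\<in>channels N. \<Sum>r\<in>rates N j h.
     pmf (activate \<phi> s) j * pmf (allocate \<phi> s j h) r * pmf \<mu> h * real (r m u))"

text \<open>Service depends on the slot through \<open>h\<close> alone and the difference is linear,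
  so only the two marginal means appear, however arrivals and channel are correlated. The constant
  \<open>c\<close> carries the state-dependent terms of a drift bound.\<close>

lemma expectation_net_input:
  assumes \<phi>: "feasible_rates \<phi>"
  shows "measure_pmf.expectation (activate \<phi> s) (\<lambda>j. measure_pmf.expectation P (\<lambda>(a, h).
      measure_pmf.expectation (allocate \<phi> s j h) (\<lambda>r. real (r m u) - real (a m u) + c))) =
    mean_service \<phi> s m u - lam m u + c"
proof -
  let ?S = "\<lambda>j h. \<Sum>r\<in>rates N j h. pmf (allocate \<phi> s j h) r * real (r m u)"
  have "measure_pmf.expectation P (\<lambda>(a, h).
      measure_pmf.expectation (allocate \<phi> s j h) (\<lambda>r. real (r m u) - real (a m u) + c)) =
      (\<Sum>h\<in>channels N. pmf \<mu> h * ?S j h) - lam m u + c" for j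
  proof -
    have "measure_pmf.expectation P (\<lambda>(a, h).
        measure_pmf.expectation (allocate \<phi> s j h) (\<lambda>r. real (r m u) - real (a m u) + c)) =
      measure_pmf.expectation P (\<lambda>x. (case x of (a, h) \<Rightarrow> ?S j h) -
        (case x of (a, h) \<Rightarrow> real (a m u)) + c)"
    proof (rule expectation_cong_pmf)
      fix x assume "x \<in> set_pmf P"
      then obtain a h where x: "x = (a, h)" and h: "h \<in> channels N"
        using slot_channel by (cases x) auto
      have "(\<Sum>r\<in>rates N j h. pmf (allocate \<phi> s j h) r * (real (r m u) - real (a m u) + c)) =
        ?S j h + (\<Sum>r\<in>rates N j h. pmf (allocate \<phi> s j h) r) * (c - real (a m u))"
        by (simp add: algebra_simps sum.distrib sum_subtractf sum_distrib_left sum_distrib_right)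
      then show "(case x of (a, h) \<Rightarrow>
          measure_pmf.expectation (allocate \<phi> s j h) (\<lambda>r. real (r m u) - real (a m u) + c)) =
          (case x of (a, h) \<Rightarrow> ?S j h) - (case x of (a, h) \<Rightarrow> real (a m u)) + c"
        by (simp add: x expectation_allocate[OF \<phi> h] sum_pmf_allocate[OF \<phi> h])
    qed
    also have "\<dots> = measure_pmf.expectation P (\<lambda>(a, h). ?S j h) -
        measure_pmf.expectation P (\<lambda>(a, h). real (a m u)) + c"
      by (subst Bochner_Integration.integral_add Bochner_Integration.integral_diff;
          (rule integrable_slot)?)+ simp
    also have "\<dots> = (\<Sum>h\<in>channels N. pmf \<mu> h * ?S j h) - lam m u + c"
      by (simp only: expectation_channel mean_arrival)
    finally show ?thesis .
  qed
  moreover have "mean_service \<phi> s m u =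
      (\<Sum>j\<in>UNIV. pmf (activate \<phi> s) j * (\<Sum>h\<in>channels N. pmf \<mu> h * ?S j h))"
    by (simp add: mean_service_def sum_distrib_left mult_ac)
  moreover have "(\<Sum>j\<in>UNIV. pmf (activate \<phi> s) j) = 1"
    by (rule sum_pmf_eq_1) auto
  then have "(\<Sum>j\<in>UNIV. pmf (activate \<phi> s) j * (G j - lam m u + c)) =
      (\<Sum>j\<in>UNIV. pmf (activate \<phi> s) j * G j) - lam m u + c" for G
    by (simp add: algebra_simps sum.distrib sum_subtractf flip: sum_distrib_left)
  ultimately show ?thesis
    by (simp add: expectation_finite_type)
qed

lemma expectation_mean_service:
  "measure_pmf.expectation \<pi> (\<lambda>s. mean_service \<phi> s m u) =
   (\<Sum>j\<in>UNIV. \<Sum>h\<in>channels N. \<Sum>r\<in>rates N j h.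
     measure_pmf.expectation \<pi> (\<lambda>s. pmf (activate \<phi> s) j * pmf (allocate \<phi> s j h) r) *
       pmf \<mu> h * real (r m u))"
  and integrable_mean_service: "integrable (measure_pmf \<pi>) (\<lambda>s. mean_service \<phi> s m u)"
proof -
  have int: "integrable (measure_pmf \<pi>) (\<lambda>s. pmf (activate \<phi> s) j * pmf (allocate \<phi> s j h) r)" for j h r
    by (rule integrable_bounded_pmf[where B = 1]) (simp add: abs_mult mult_le_one pmf_le_1)
  show "integrable (measure_pmf \<pi>) (\<lambda>s. mean_service \<phi> s m u)"
    by (simp add: mean_service_def int)
  show "measure_pmf.expectation \<pi> (\<lambda>s. mean_service \<phi> s m u) =
   (\<Sum>j\<in>UNIV. \<Sum>h\<in>channels N. \<Sum>r\<in>rates N j h.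
     measure_pmf.expectation \<pi> (\<lambda>s. pmf (activate \<phi> s) j * pmf (allocate \<phi> s j h) r) *
       pmf \<mu> h * real (r m u))"
    by (simp add: mean_service_def int Bochner_Integration.integral_sum)
qed

text \<open>The queue may have infinite stationary mean, so the balance of the truncation
  \<open>min Q K\<close> is used; truncating loses at most \<open>Abar\<close>, and only on the event \<open>Q > K - Abar\<close>.\<close>

lemma stationary_service:
  assumes \<phi>: "feasible_rates \<phi>" and inv: "bind_pmf \<pi> (step P \<phi>) = \<pi>"
  shows "lam m u \<le> measure_pmf.expectation \<pi> (\<lambda>s. mean_service \<phi> s m u)"
proof -
  have trunc: "lam m u \<le> measure_pmf.expectation \<pi> (\<lambda>s. mean_service \<phi> s m u) +
      real Abar * measure_pmf.prob \<pi> {s. k < snd s m u}" for k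
  proof -
    define g :: "('m, 'u) state \<Rightarrow> real" where "g s = real (min (snd s m u) (k + Abar))" for s
    define d :: "('m, 'u) state \<Rightarrow> real" where "d s = real Abar * indicator {s. k < snd s m u} s" for s
    have intg: "integrable (measure_pmf p) g" for p
      by (rule integrable_bounded_pmf[where B = "real (k + Abar)"]) (simp add: g_def)
    have intd: "integrable (measure_pmf \<pi>) d"
      by (rule integrable_bounded_pmf[where B = "real Abar"]) (simp add: d_def indicator_def)
    have stepg: "g s + lam m u - mean_service \<phi> s m u - d s \<le> measure_pmf.expectation (step P \<phi> s) g" for s
    proof -
      \<comment> \<open>A lower bound on the growth of \<open>g\<close> is wanted, so the one-sided
        transition lemma is applied to its negative.\<close>
      have "measure_pmf.expectation (step P \<phi> s) (\<lambda>x. - g x) \<le>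
        measure_pmf.expectation (activate \<phi> s) (\<lambda>j. measure_pmf.expectation P (\<lambda>(a, h).
          measure_pmf.expectation (allocate \<phi> s j h) (\<lambda>r. real (r m u) - real (a m u) + (d s - g s))))"
      proof (rule expectation_step_le[OF \<phi>])
        fix j a h r assume "(a, h) \<in> set_pmf P"
        then have "a m u \<le> Abar" by (rule slot_arrival_le)
        then show "- g (j, \<lambda>m u. (snd s m u + a m u) - r m u) \<le>
            real (r m u) - real (a m u) + (d s - g s)"
          by (auto simp: g_def d_def indicator_def min_def)
      qed
      then show ?thesis by (simp add: expectation_net_input[OF \<phi>])
    qed
    have "measure_pmf.expectation \<pi> (\<lambda>s. g s + lam m u - mean_service \<phi> s m u - d s) \<le>
        measure_pmf.expectation \<pi> (\<lambda>s. measure_pmf.expectation (step P \<phi> s) g)"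
    proof (intro integral_mono stepg)
      show "integrable (measure_pmf \<pi>) (\<lambda>s. measure_pmf.expectation (step P \<phi> s) g)"
      proof (rule integrable_bounded_pmf[where B = "real (k + Abar)"])
        fix s
        have "measure_pmf.expectation (step P \<phi> s) g \<le> real (k + Abar)"
          by (intro measure_pmf.integral_le_const intg) (simp add: g_def)
        moreover have "0 \<le> measure_pmf.expectation (step P \<phi> s) g"
          by (rule integral_nonneg_AE) (simp add: g_def)
        ultimately show "\<bar>measure_pmf.expectation (step P \<phi> s) g\<bar> \<le> real (k + Abar)" by simp
      qed
    qed (simp add: intg intd integrable_mean_service)
    also have "\<dots> = measure_pmf.expectation (bind_pmf \<pi> (step P \<phi>)) g"
      by (rule expectation_bind_bounded[symmetric, where B = "real (k + Abar)"]) (auto simp: g_def)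
    also have "\<dots> = measure_pmf.expectation \<pi> g" by (simp add: inv)
    also have "measure_pmf.expectation \<pi> (\<lambda>s. g s + lam m u - mean_service \<phi> s m u - d s) =
        measure_pmf.expectation \<pi> g + lam m u -
        measure_pmf.expectation \<pi> (\<lambda>s. mean_service \<phi> s m u) -
        real Abar * measure_pmf.prob \<pi> {s. k < snd s m u}"
    proof -
      have "measure_pmf.expectation \<pi> d = real Abar * measure_pmf.prob \<pi> {s. k < snd s m u}"
        unfolding d_def by simp
      then show ?thesis by (simp add: intg intd integrable_mean_service)
    qed
    finally show ?thesis by linarith
  qed
  show ?thesis
  proof (rule field_le_epsilon)
    fix e :: real assume "0 < e"
    then obtain F where F: "finite F" "measure_pmf.prob \<pi> (- F) < e / (real Abar + 1)"
      using pmf_finite_tail[of "e / (real Abar + 1)" \<pi>] by auto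
    \<comment> \<open>No state of \<open>F\<close> has a queue beyond \<open>k\<close>, so the
      truncation error lives on the small tail. The \<open>+ 1\<close> in the tolerance covers
      \<open>Abar = 0\<close>.\<close>
    define k where "k = Max (insert 0 ((\<lambda>s. snd s m u) ` F))"
    have "{s. k < snd s m u} \<subseteq> - F"
    proof
      fix s :: "('m, 'u) state" assume "s \<in> {s. k < snd s m u}"
      moreover have "snd s m u \<le> k" if "s \<in> F" using F(1) that by (simp add: k_def)
      ultimately show "s \<in> - F" by force
    qed
    then have "measure_pmf.prob \<pi> {s. k < snd s m u} \<le> measure_pmf.prob \<pi> (- F)"
      by (intro measure_pmf.finite_measure_mono) auto
    with F have "measure_pmf.prob \<pi> {s. k < snd s m u} \<le> e / (real Abar + 1)" by linarith
    then have "real Abar * measure_pmf.prob \<pi> {s. k < snd s m u} \<le> (real Abar + 1) * (e / (real Abar + 1))"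
      by (intro mult_mono) auto
    then show "lam m u \<le> measure_pmf.expectation \<pi> (\<lambda>s. mean_service \<phi> s m u) + e"
      using trunc[of k] by simp
  qed
qed

text \<open>Here \<beta> is the stationary frequency of choosing \<open>j\<close> and of answering
  channel \<open>h\<close> with \<open>r\<close>. Activation is drawn before the channel is seen, so
  summing over \<open>r\<close> gives the same value for every \<open>h\<close>, as the program
  demands.\<close>

lemma stationary_lp_feasible:
  assumes \<phi>: "feasible_rates \<phi>" and inv: "bind_pmf \<pi> (step P \<phi>) = \<pi>"
  shows "lp_feasible N \<mu> lam (bind_pmf \<pi> (activate \<phi>),
    \<lambda>j h r. measure_pmf.expectation \<pi> (\<lambda>s. pmf (activate \<phi> s) j * pmf (allocate \<phi> s j h) r))"
proof -
  have "pmf (bind_pmf \<pi> (activate \<phi>)) j = (\<Sum>r\<in>rates N j h.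
      measure_pmf.expectation \<pi> (\<lambda>s. pmf (activate \<phi> s) j * pmf (allocate \<phi> s j h) r))"
    if h: "h \<in> channels N" for j h
  proof -
    have "pmf (bind_pmf \<pi> (activate \<phi>)) j = measure_pmf.expectation \<pi> (\<lambda>s. \<Sum>r\<in>rates N j h.
        pmf (activate \<phi> s) j * pmf (allocate \<phi> s j h) r)"
      by (simp add: pmf_bind sum_pmf_allocate[OF \<phi> h] flip: sum_distrib_left)
    also have "\<dots> = (\<Sum>r\<in>rates N j h.
        measure_pmf.expectation \<pi> (\<lambda>s. pmf (activate \<phi> s) j * pmf (allocate \<phi> s j h) r))"
      by (intro Bochner_Integration.integral_sum integrable_bounded_pmf[where B = 1])
         (simp add: abs_mult mult_le_one pmf_le_1)
    finally show ?thesis .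
  qed
  moreover have "lam m u \<le> (\<Sum>j\<in>UNIV. \<Sum>h\<in>channels N. \<Sum>r\<in>rates N j h.
     measure_pmf.expectation \<pi> (\<lambda>s. pmf (activate \<phi> s) j * pmf (allocate \<phi> s j h) r) *
       pmf \<mu> h * real (r m u))" for m u
    using stationary_service[OF \<phi> inv, of m u] by (simp only: expectation_mean_service)
  ultimately show ?thesis
    by (auto simp: lp_feasible_def)
qed

section \<open>Costs along the chain and under its invariant law\<close>

lemma expected_cost_Suc:
  assumes \<phi>: "feasible_rates \<phi>"
  shows "expected_cost N P \<phi> s (Suc k) =
    measure_pmf.expectation (iterate_kernel (step P \<phi>) k s)
      (\<lambda>x. measure_pmf.expectation (activate \<phi> x) (slot_cost N (fst x)))"
  using finite_set_pmf_iterate_kernel[of "step P \<phi>", OF finite_set_pmf_step[OF \<phi>]]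
  by (simp add: expected_cost_def state_at_def expectation_bind_finite)

definition activation_cost :: "('m, 'c, 'u) policy \<Rightarrow> ('m, 'u) state \<Rightarrow> real" where
  "activation_cost \<phi> s = (\<Sum>j\<in>UNIV. pmf (activate \<phi> s) j * (active_cost N * real (card j)))"

lemma activation_cost_nonneg: "0 \<le> activation_cost \<phi> s"
  by (auto simp: activation_cost_def active_cost_nonneg intro!: sum_nonneg)

lemma average_card_le:
  fixes \<sigma> :: "'m set pmf"
  shows "(\<Sum>j\<in>UNIV. pmf \<sigma> j * (active_cost N * real (card j))) \<le> active_cost N * real CARD('m)"
proof -
  have "(\<Sum>j\<in>UNIV. pmf \<sigma> j * (active_cost N * real (card j))) \<le>
      (\<Sum>j\<in>UNIV. pmf \<sigma> j * (active_cost N * real CARD('m)))"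
    by (intro sum_mono mult_left_mono) (auto simp: active_cost_nonneg card_mono)
  also have "\<dots> = active_cost N * real CARD('m)"
    using sum_pmf_eq_1[of UNIV \<sigma>] by (simp flip: sum_distrib_right)
  finally show ?thesis .
qed

lemma lp_objective_activation:
  "lp_objective N (activation_objective N) (\<sigma>, \<beta>) =
   (\<Sum>j\<in>UNIV. pmf \<sigma> j * (active_cost N * real (card j)))"
  by (simp add: lp_objective_def activation_objective_def mult_ac)

lemma stationary_objective:
  "lp_objective N (activation_objective N) (bind_pmf \<pi> (activate \<phi>), \<beta>) =
   measure_pmf.expectation \<pi> (activation_cost \<phi>)"
proof -
  have int: "integrable (measure_pmf \<pi>) (\<lambda>s. pmf (activate \<phi> s) j)" for j
    by (rule integrable_bounded_pmf[where B = 1]) (simp add: pmf_le_1)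
  then show ?thesis
    by (simp add: lp_objective_activation activation_cost_def[abs_def] pmf_bind Bochner_Integration.integral_sum)
qed

lemma activation_cost_le_expected_cost:
  assumes \<phi>: "feasible_rates \<phi>"
  shows "measure_pmf.expectation (iterate_kernel (step P \<phi>) k s) (activation_cost \<phi>) \<le>
    expected_cost N P \<phi> s (Suc k)"
  unfolding expected_cost_Suc[OF \<phi>]
proof (intro expectation_mono_pmf finite_set_pmf_iterate_kernel finite_set_pmf_step[OF \<phi>])
  fix x
  show "activation_cost \<phi> x \<le> measure_pmf.expectation (activate \<phi> x) (slot_cost N (fst x))"
    unfolding activation_cost_def expectation_finite_type
    by (intro sum_mono mult_left_mono) (auto simp: slot_cost_def switch_cost_nonneg)
qed

text \<open>Dropping the switching cost and all states outside a finite \<open>F\<close> only lowers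
  the cost along the chain. What remains is a finite sum, which converges, also in Cesaro mean, to
  its stationary value; under the invariant law the part outside \<open>F\<close> is worth at most
  \<open>e\<close>.\<close>

lemma ergodic_activation_cost_le:
  assumes \<phi>: "feasible_rates \<phi>"
    and lim: "\<And>x y. (\<lambda>k. pmf (iterate_kernel (step P \<phi>) k x) y) \<longlonglongrightarrow> pmf \<pi> y"
  shows "ereal (measure_pmf.expectation \<pi> (activation_cost \<phi>)) \<le> network_cost N P \<phi> s"
proof (rule ereal_le_epsilon2)
  fix e :: real assume e: "0 < e"
  let ?B = "active_cost N * real CARD('m)"
  have bound: "activation_cost \<phi> x \<le> ?B" for x
    unfolding activation_cost_def by (rule average_card_le)
  \<comment> \<open>The \<open>+ 1\<close> keeps the denominator positive when activation is
    free.\<close>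
  obtain F where F: "finite F" "measure_pmf.prob \<pi> (- F) < e / (?B + 1)"
    using pmf_finite_tail[of "e / (?B + 1)" \<pi>] e active_cost_nonneg
    by (auto simp: add_nonneg_pos)
  let ?y = "\<lambda>k. \<Sum>x\<in>F. pmf (iterate_kernel (step P \<phi>) k s) x * activation_cost \<phi> x"
  let ?L = "\<Sum>x\<in>F. pmf \<pi> x * activation_cost \<phi> x"
  have "?y \<longlonglongrightarrow> ?L" by (intro tendsto_intros lim)
  from cesaro_mean_LIMSEQ[OF this]
  have "limsup (\<lambda>T. ereal (1 / real T * (\<Sum>k<T. ?y k))) = ereal ?L"
    by (intro lim_imp_Limsup) auto
  moreover have "limsup (\<lambda>T. ereal (1 / real T * (\<Sum>k<T. ?y k))) \<le> network_cost N P \<phi> s"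
    unfolding network_cost_def
  proof (intro Limsup_mono always_eventually allI)
    fix T
    have "?y k \<le> expected_cost N P \<phi> s (Suc k)" for k
    proof -
      have "?y k \<le> measure_pmf.expectation (iterate_kernel (step P \<phi>) k s) (activation_cost \<phi>)"
        by (intro finite_part_le_expectation F activation_cost_nonneg integrable_measure_pmf_finite
            finite_set_pmf_iterate_kernel finite_set_pmf_step[OF \<phi>])
      also have "\<dots> \<le> expected_cost N P \<phi> s (Suc k)"
        by (rule activation_cost_le_expected_cost[OF \<phi>])
      finally show ?thesis .
    qed
    then have "(\<Sum>k<T. ?y k) \<le> (\<Sum>t=1..T. expected_cost N P \<phi> s t)"
      by (simp add: sum.atLeast1_atMost_eq sum_mono)
    then show "ereal (1 / real T * (\<Sum>k<T. ?y k)) \<le>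
        ereal (1 / real T * (\<Sum>t=1..T. expected_cost N P \<phi> s t))"
      by (simp add: divide_right_mono)
  qed
  moreover have "measure_pmf.expectation \<pi> (activation_cost \<phi>) \<le> ?L + e"
  proof -
    have "measure_pmf.expectation \<pi> (activation_cost \<phi>) \<le> ?L + ?B * measure_pmf.prob \<pi> (- F)"
      by (rule expectation_le_finite_part[OF F(1) activation_cost_nonneg bound])
    moreover have "?B * measure_pmf.prob \<pi> (- F) \<le> (?B + 1) * (e / (?B + 1))"
      using F(2) active_cost_nonneg by (intro mult_mono) auto
    moreover have "(?B + 1) * (e / (?B + 1)) = e"
      using active_cost_nonneg by (simp add: add_nonneg_pos less_imp_neq[symmetric])
    ultimately show ?thesis by linarith
  qed
  ultimately have "ereal ?L \<le> network_cost N P \<phi> s"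
    and le: "ereal (measure_pmf.expectation \<pi> (activation_cost \<phi>)) \<le> ereal ?L + ereal e"
    by simp_all
  from this(1) have "ereal ?L + ereal e \<le> network_cost N P \<phi> s + ereal e"
    by (rule add_right_mono)
  with le show "ereal (measure_pmf.expectation \<pi> (activation_cost \<phi>)) \<le> network_cost N P \<phi> s + ereal e"
    by (rule order_trans)
qed

lemma ergodic_lp_bound:
  assumes "\<phi> \<in> ergodic_policies N P"
  shows "\<exists>x. lp_feasible N \<mu> lam x \<and>
    ereal (lp_objective N (activation_objective N) x) \<le> network_cost N P \<phi> s"
proof -
  have \<phi>: "feasible_rates \<phi>"
    using assms unfolding ergodic_policies_def admissible_def feasible_rates_def by blast
  from assms have "ergodic_kernel (step P \<phi>)"
    by (simp add: ergodic_policies_def)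
  then obtain \<pi> where inv: "bind_pmf \<pi> (step P \<phi>) = \<pi>"
    and lim: "\<And>x y. (\<lambda>k. pmf (iterate_kernel (step P \<phi>) k x) y) \<longlonglongrightarrow> pmf \<pi> y"
    unfolding ergodic_kernel_def by (elim exE conjE) (rule that, assumption, erule allE, erule spec)
  show ?thesis
    by (intro exI conjI, rule stationary_lp_feasible[OF \<phi> inv])
       (simp only: stationary_objective ergodic_activation_cost_le[OF \<phi> lim])
qed


section \<open>Sensitivity of the linear program\<close>

lemma lp_objective_nonneg: "0 \<le> lp_objective N (activation_objective N) x"
  using active_cost_nonneg by (cases x) (auto simp: lp_objective_activation intro!: sum_nonneg)

lemma lp_objective_le: "lp_objective N (activation_objective N) x \<le> active_cost N * real CARD('m)"
  by (cases x) (simp add: lp_objective_activation average_card_le)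

text \<open>Constraints and objective are jointly linear in the arrival rates and the variables;
  this is the source of convexity of the optimal value.\<close>

lemma lp_feasible_mix:
  assumes x0: "lp_feasible N \<mu> lam0 x0" and x1: "lp_feasible N \<mu> lam1 x1" and \<theta>: "0 \<le> \<theta>" "\<theta> \<le> 1"
  shows "\<exists>x. lp_feasible N \<mu> (\<lambda>m u. (1 - \<theta>) * lam0 m u + \<theta> * lam1 m u) x \<and>
    lp_objective N (activation_objective N) x =
    (1 - \<theta>) * lp_objective N (activation_objective N) x0 + \<theta> * lp_objective N (activation_objective N) x1"
proof -
  obtain \<sigma>0 \<beta>0 \<sigma>1 \<beta>1 where x: "x0 = (\<sigma>0, \<beta>0)" "x1 = (\<sigma>1, \<beta>1)" by (cases x0, cases x1)
  \<comment> \<open>A coin of bias \<theta> realizes the convex combination as a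
    \<open>pmf\<close>.\<close>
  define \<sigma> where "\<sigma> = bind_pmf (bernoulli_pmf \<theta>) (\<lambda>b. if b then \<sigma>1 else \<sigma>0)"
  define \<beta> where "\<beta> j h r = (1 - \<theta>) * \<beta>0 j h r + \<theta> * \<beta>1 j h r" for j h r
  have \<sigma>: "pmf \<sigma> j = (1 - \<theta>) * pmf \<sigma>0 j + \<theta> * pmf \<sigma>1 j" for j
    using \<theta> by (simp add: \<sigma>_def pmf_bind)
  have "(1 - \<theta>) * lam0 m u + \<theta> * lam1 m u \<le>
      (\<Sum>j\<in>UNIV. \<Sum>h\<in>channels N. \<Sum>r\<in>rates N j h. \<beta> j h r * pmf \<mu> h * real (r m u))" for m u
  proof -
    have "(1 - \<theta>) * lam0 m u + \<theta> * lam1 m u \<le>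
      (1 - \<theta>) * (\<Sum>j\<in>UNIV. \<Sum>h\<in>channels N. \<Sum>r\<in>rates N j h. \<beta>0 j h r * pmf \<mu> h * real (r m u)) +
      \<theta> * (\<Sum>j\<in>UNIV. \<Sum>h\<in>channels N. \<Sum>r\<in>rates N j h. \<beta>1 j h r * pmf \<mu> h * real (r m u))"
      using x0 x1 \<theta> by (intro add_mono mult_left_mono) (auto simp: x lp_feasible_def)
    also have "\<dots> = (\<Sum>j\<in>UNIV. \<Sum>h\<in>channels N. \<Sum>r\<in>rates N j h. \<beta> j h r * pmf \<mu> h * real (r m u))"
      by (simp add: \<beta>_def sum_distrib_left distrib_right distrib_left mult_ac sum.distrib)
    finally show ?thesis .
  qed
  moreover have "pmf \<sigma> j = (\<Sum>r\<in>rates N j h. \<beta> j h r)" if "h \<in> channels N" for j h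
    using x0 x1 that by (simp add: x lp_feasible_def \<sigma> \<beta>_def sum.distrib sum_distrib_left)
  moreover have "0 \<le> \<beta> j h r" if "h \<in> channels N" "r \<in> rates N j h" for j h r
    using x0 x1 that \<theta> by (simp add: x lp_feasible_def \<beta>_def)
  ultimately have "lp_feasible N \<mu> (\<lambda>m u. (1 - \<theta>) * lam0 m u + \<theta> * lam1 m u) (\<sigma>, \<beta>)"
    by (simp add: lp_feasible_def)
  moreover have "lp_objective N (activation_objective N) (\<sigma>, \<beta>) =
    (1 - \<theta>) * lp_objective N (activation_objective N) x0 + \<theta> * lp_objective N (activation_objective N) x1"
    unfolding x lp_objective_activation \<sigma> by (simp add: sum_distrib_left distrib_right distrib_left mult_ac sum.distrib)
  ultimately show ?thesis by blast
qed

text \<open>The optimum at \<open>lam + e\<close> is tested against the point at fraction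
  \<open>e / e1\<close> of the way from \<open>x0\<close> to \<open>x1\<close>. Moving there costs
  at most that fraction of the largest possible objective, that of keeping all stations
  active.\<close>

lemma lp_optimum_sensitivity:
  assumes x0: "lp_feasible N \<mu> lam x0"
    and e1: "0 < e1" and x1: "lp_feasible N \<mu> (\<lambda>m u. lam m u + e1) x1"
    and e: "0 < e" and opt: "lp_optimal N (activation_objective N) \<mu> (\<lambda>m u. lam m u + e) x"
  shows "lp_objective N (activation_objective N) x \<le>
    lp_objective N (activation_objective N) x0 + active_cost N * real CARD('m) / e1 * e"
proof (cases "e \<le> e1")
  case True
  define \<theta> where "\<theta> = e / e1"
  have \<theta>: "0 \<le> \<theta>" "\<theta> \<le> 1" using e e1 True by (auto simp: \<theta>_def)
  have "(\<lambda>m u. (1 - \<theta>) * lam m u + \<theta> * (lam m u + e1)) = (\<lambda>m u. lam m u + e)"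
    using e1 by (simp add: \<theta>_def algebra_simps)
  with lp_feasible_mix[OF x0 x1 \<theta>] obtain y where y: "lp_feasible N \<mu> (\<lambda>m u. lam m u + e) y"
    "lp_objective N (activation_objective N) y =
      (1 - \<theta>) * lp_objective N (activation_objective N) x0 + \<theta> * lp_objective N (activation_objective N) x1"
    by auto
  have "lp_objective N (activation_objective N) x \<le> lp_objective N (activation_objective N) y"
    using opt y(1) unfolding lp_optimal_def is_arg_min_def by (meson not_less)
  also have "\<dots> \<le> 1 * lp_objective N (activation_objective N) x0 + \<theta> * (active_cost N * real CARD('m))"
    unfolding y(2) using \<theta> by (intro add_mono mult_mono lp_objective_le lp_objective_nonneg) auto
  finally show ?thesis by (simp add: \<theta>_def mult_ac)
next
  case False
  \<comment> \<open>Beyond \<open>e1\<close> the linear term alone exceeds the trivial bound on any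
    objective.\<close>
  have "lp_objective N (activation_objective N) x \<le> active_cost N * real CARD('m) * 1"
    using lp_objective_le by simp
  also have "\<dots> \<le> active_cost N * real CARD('m) * (e / e1)"
    using False e1 active_cost_nonneg by (intro mult_left_mono) auto
  finally show ?thesis using lp_objective_nonneg[of x0] by simp
qed


section \<open>Static-split activation\<close>

lemma static_split_cost:
  assumes \<phi>: "feasible_rates \<phi>"
    and act: "\<And>i q. activate \<phi> (i, q) = do { b \<leftarrow> bernoulli_pmf \<epsilon>; if b then \<sigma> else return_pmf i }"
    and \<epsilon>: "0 < \<epsilon>" "\<epsilon> < 1"
  shows "network_cost N P \<phi> s \<le> ereal (switch_cost N * real CARD('m) * \<epsilon> +
    lp_objective N (activation_objective N) (\<sigma>, \<beta>))"
proof -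
  let ?c = "\<lambda>j :: 'm set. active_cost N * real (card j)"
  let ?A = "switch_cost N * real CARD('m) * \<epsilon>"
  define y where "y = measure_pmf.expectation \<sigma> ?c"
  define z where "z k = measure_pmf.expectation (iterate_kernel (step P \<phi>) k s) (\<lambda>x. ?c (fst x))" for k
  have y: "lp_objective N (activation_objective N) (\<sigma>, \<beta>) = y"
    unfolding lp_objective_activation y_def expectation_finite_type ..
  have act': "measure_pmf.expectation (activate \<phi> x) f =
      \<epsilon> * measure_pmf.expectation \<sigma> f + (1 - \<epsilon>) * f (fst x)" for x f
    using \<epsilon> by (cases x) (simp add: act expectation_static_split)
  note fin = finite_set_pmf_iterate_kernel[of "step P \<phi>", OF finite_set_pmf_step[OF \<phi>]]
  note int = integrable_measure_pmf_finite[OF fin]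
  \<comment> \<open>The activation law ignores the queues, so the mean activation cost obeys a
    closed recursion and approaches \<open>y\<close> geometrically from any initial state.\<close>
  have z_Suc: "z (Suc k) = \<epsilon> * y + (1 - \<epsilon>) * z k" for k
  proof -
    have "z (Suc k) = measure_pmf.expectation (iterate_kernel (step P \<phi>) k s)
        (\<lambda>x. measure_pmf.expectation (step P \<phi> x) (\<lambda>x. ?c (fst x)))"
      unfolding z_def iterate_kernel_Suc
      by (rule expectation_bind_finite) (auto intro: fin finite_set_pmf_step[OF \<phi>])
    also have "\<dots> = measure_pmf.expectation (iterate_kernel (step P \<phi>) k s)
        (\<lambda>x. \<epsilon> * y + (1 - \<epsilon>) * ?c (fst x))"
    proof -
      have "measure_pmf.expectation (step P \<phi> x) (\<lambda>x. ?c (fst x)) =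
          measure_pmf.expectation (activate \<phi> x) ?c" for x
        by (simp add: expectation_step[OF \<phi>] case_prod_unfold)
      then show ?thesis by (simp only: act' y_def)
    qed
    also have "\<dots> = \<epsilon> * y + (1 - \<epsilon>) * z k"
      unfolding z_def by (simp add: int)
    finally show ?thesis .
  qed
  have "z k - y = (1 - \<epsilon>) ^ k * (z 0 - y)" for k
  proof (induction k)
    case (Suc k)
    have "z (Suc k) - y = (1 - \<epsilon>) * (z k - y)" by (simp add: z_Suc algebra_simps)
    with Suc show ?case by simp
  qed simp
  then have z: "z = (\<lambda>k. y + (1 - \<epsilon>) ^ k * (z 0 - y))" by (auto simp: fun_eq_iff algebra_simps)
  have "(\<lambda>k. y + (1 - \<epsilon>) ^ k * (z 0 - y)) \<longlonglongrightarrow> y + 0 * (z 0 - y)"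
    using \<epsilon> by (intro tendsto_intros LIMSEQ_power_zero) auto
  then have "z \<longlonglongrightarrow> y" by (subst z) simp
  then have "(\<lambda>k. ?A + z (Suc k)) \<longlonglongrightarrow> ?A + y"
    by (intro tendsto_intros LIMSEQ_Suc)
  from cesaro_mean_LIMSEQ[OF this]
  have "limsup (\<lambda>T. ereal (1 / real T * (\<Sum>k<T. ?A + z (Suc k)))) = ereal (?A + y)"
    by (intro lim_imp_Limsup) auto
  moreover have "network_cost N P \<phi> s \<le> limsup (\<lambda>T. ereal (1 / real T * (\<Sum>k<T. ?A + z (Suc k))))"
    unfolding network_cost_def
  proof (intro Limsup_mono always_eventually allI)
    fix T
    \<comment> \<open>The activation of slot \<open>Suc k\<close> becomes the first state component
      only after \<open>k + 1\<close> transitions, hence \<open>z (Suc k)\<close>. A kept state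
      switches nothing off; a redraw, of probability \<epsilon>, switches off at most all stations.
      This is the origin of \<kappa>.\<close>
    have "expected_cost N P \<phi> s (Suc k) \<le> ?A + z (Suc k)" for k
    proof -
      have "measure_pmf.expectation (activate \<phi> x) (slot_cost N (fst x)) \<le>
          ?A + (\<epsilon> * y + (1 - \<epsilon>) * ?c (fst x))" for x
      proof -
        have "measure_pmf.expectation \<sigma> (slot_cost N (fst x)) \<le>
            measure_pmf.expectation \<sigma> (\<lambda>j. switch_cost N * real CARD('m) + ?c j)"
          by (intro expectation_mono_pmf)
             (auto simp: slot_cost_def switch_cost_nonneg intro!: mult_left_mono card_mono)
        also have "\<dots> = switch_cost N * real CARD('m) + y"
          unfolding y_def by (subst Bochner_Integration.integral_add)
            (auto intro: integrable_measure_pmf_finite)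
        finally have "\<epsilon> * measure_pmf.expectation \<sigma> (slot_cost N (fst x)) \<le>
            \<epsilon> * (switch_cost N * real CARD('m) + y)"
          using \<epsilon> by (intro mult_left_mono) auto
        then show ?thesis by (simp add: act' slot_cost_def algebra_simps)
      qed
      then have "expected_cost N P \<phi> s (Suc k) \<le> measure_pmf.expectation (iterate_kernel (step P \<phi>) k s)
          (\<lambda>x. ?A + (\<epsilon> * y + (1 - \<epsilon>) * ?c (fst x)))"
        unfolding expected_cost_Suc[OF \<phi>] by (intro expectation_mono_pmf fin)
      also have "\<dots> = ?A + z (Suc k)"
        unfolding z_Suc unfolding z_def by (simp add: int)
      finally show ?thesis .
    qed
    then have "(\<Sum>t=1..T. expected_cost N P \<phi> s t) \<le> (\<Sum>k<T. ?A + z (Suc k))"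
      unfolding One_nat_def sum.atLeast1_atMost_eq by (intro sum_mono)
    then show "ereal (1 / real T * (\<Sum>t=1..T. expected_cost N P \<phi> s t)) \<le>
        ereal (1 / real T * (\<Sum>k<T. ?A + z (Suc k)))"
      unfolding ereal_less_eq by (intro mult_left_mono) auto
  qed
  ultimately show ?thesis by (simp add: y)
qed


section \<open>Max-Weight\<close>

definition queue_total :: "('m, 'u) vec \<Rightarrow> real" where
  "queue_total q = (\<Sum>m\<in>UNIV. \<Sum>u\<in>UNIV. real (q m u))"

definition max_weight :: "('m, 'u) vec \<Rightarrow> 'm set \<Rightarrow> ('m \<Rightarrow> 'c) \<Rightarrow> real" where
  "max_weight q j h = real (Max (weight q ` rates N j h))"

text \<open>The queue-weighted mean service of Max-Weight given activation \<open>j\<close>, common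
  to all ways of breaking ties.\<close>

definition mean_max_weight :: "('m, 'u) vec \<Rightarrow> 'm set \<Rightarrow> real" where
  "mean_max_weight q j = (\<Sum>h\<in>channels N. pmf \<mu> h * max_weight q j h)"

lemma real_weight: "real (weight q r) = (\<Sum>m\<in>UNIV. \<Sum>u\<in>UNIV. real (q m u) * real (r m u))"
  by (simp add: weight_def)

lemma weight_le_max_weight:
  "h \<in> channels N \<Longrightarrow> r \<in> rates N j h \<Longrightarrow> real (weight q r) \<le> max_weight q j h"
  by (simp add: max_weight_def finite_rates)

lemma max_weight_attained:
  assumes "h \<in> channels N"
  obtains r where "r \<in> rates N j h" "max_weight q j h = real (weight q r)"
proof -
  have "Max (weight q ` rates N j h) \<in> weight q ` rates N j h"
    using assms by (intro Max_in) (auto simp: finite_rates rates_nonempty)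
  then show ?thesis by (auto simp: max_weight_def intro: that)
qed

lemma is_arg_max_weight:
  assumes "h \<in> channels N" "is_arg_max (weight q) (\<lambda>r. r \<in> rates N j h) r"
  shows "real (weight q r) = max_weight q j h"
proof -
  obtain r' where r': "r' \<in> rates N j h" "max_weight q j h = real (weight q r')"
    using max_weight_attained[OF assms(1)] .
  with assms(2) have "weight q r' \<le> weight q r" by (auto simp: is_arg_max_def not_less)
  moreover have "real (weight q r) \<le> max_weight q j h"
    using assms by (intro weight_le_max_weight) (auto simp: is_arg_max_def)
  ultimately show ?thesis using r' by simp
qed

lemma max_weight_le:
  assumes h: "h \<in> channels N"
  shows "max_weight q j h \<le> real (max_rate N) * queue_total q"
proof -
  obtain r where r: "r \<in> rates N j h" "max_weight q j h = real (weight q r)"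
    using max_weight_attained[OF h] .
  have "real (weight q r) \<le> (\<Sum>m\<in>UNIV. \<Sum>u\<in>UNIV. real (q m u) * real (max_rate N))"
    unfolding real_weight by (intro sum_mono mult_left_mono) (auto simp: rates_le[OF h r(1)])
  then show ?thesis by (simp add: r queue_total_def sum_distrib_left mult_ac)
qed

lemma mean_max_weight_le: "mean_max_weight q j \<le> real (max_rate N) * queue_total q"
proof -
  have "mean_max_weight q j \<le> (\<Sum>h\<in>channels N. pmf \<mu> h * (real (max_rate N) * queue_total q))"
    unfolding mean_max_weight_def by (intro sum_mono mult_left_mono max_weight_le) auto
  also have "\<dots> = real (max_rate N) * queue_total q"
    by (simp add: sum_pmf_channel flip: sum_distrib_right)
  finally show ?thesis .
qed

text \<open>A maximizer for \<open>q\<close> is a candidate for \<open>q'\<close>. The one-sided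
  form matches the dynamics: a queue drops by at most \<open>max_rate N\<close> per slot, and the
  correction enters the Lyapunov function with a minus sign.\<close>

lemma mean_max_weight_lipschitz:
  assumes "\<And>m u. q m u \<le> q' m u + max_rate N"
  shows "mean_max_weight q j \<le> mean_max_weight q' j +
    real CARD('m) * real CARD('u) * (real (max_rate N))\<^sup>2"
proof -
  let ?D = "real CARD('m) * real CARD('u) * (real (max_rate N))\<^sup>2"
  have "max_weight q j h \<le> max_weight q' j h + ?D" if h: "h \<in> channels N" for h
  proof -
    obtain r where r: "r \<in> rates N j h" "max_weight q j h = real (weight q r)"
      using max_weight_attained[OF h] .
    have "real (q m u) * real (r m u) \<le> real (q' m u) * real (r m u) + (real (max_rate N))\<^sup>2" for m u
    proof -
      have "real (q m u) * real (r m u) \<le> (real (q' m u) + real (max_rate N)) * real (r m u)"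
        using assms[of m u] by (intro mult_right_mono) auto
      also have "\<dots> = real (q' m u) * real (r m u) + real (max_rate N) * real (r m u)"
        by (simp add: distrib_right)
      also have "real (max_rate N) * real (r m u) \<le> (real (max_rate N))\<^sup>2"
        unfolding power2_eq_square by (intro mult_left_mono) (auto simp: rates_le[OF h r(1)])
      finally show ?thesis by simp
    qed
    then have "real (weight q r) \<le>
        (\<Sum>m\<in>UNIV. \<Sum>u\<in>UNIV. real (q' m u) * real (r m u) + (real (max_rate N))\<^sup>2)"
      unfolding real_weight by (intro sum_mono)
    also have "\<dots> = real (weight q' r) + ?D"
      by (simp add: real_weight sum.distrib)
    also have "real (weight q' r) \<le> max_weight q' j h"
      by (rule weight_le_max_weight[OF h r(1)])
    finally show ?thesis by (simp add: r)
  qed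
  then have "mean_max_weight q j \<le> (\<Sum>h\<in>channels N. pmf \<mu> h * (max_weight q' j h + ?D))"
    unfolding mean_max_weight_def by (intro sum_mono mult_left_mono) auto
  also have "\<dots> = mean_max_weight q' j + ?D"
    by (simp add: mean_max_weight_def distrib_left sum.distrib sum_pmf_channel flip: sum_distrib_right)
  finally show ?thesis .
qed

text \<open>For each \<open>j\<close> and \<open>h\<close>, \<beta> spreads the mass of
  \<open>j\<close> over the available rates, and an average of weights is at most their maximum.
  Max-Weight thus does at least as well as the static rate split \<beta> without using it.\<close>

lemma lp_feasible_max_weight:
  assumes "lp_feasible N \<mu> l (\<sigma>, \<beta>)"
  shows "(\<Sum>m\<in>UNIV. \<Sum>u\<in>UNIV. real (q m u) * l m u) \<le> measure_pmf.expectation \<sigma> (mean_max_weight q)"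
proof -
  have "(\<Sum>m\<in>UNIV. \<Sum>u\<in>UNIV. real (q m u) * l m u) \<le> (\<Sum>m\<in>UNIV. \<Sum>u\<in>UNIV. real (q m u) *
      (\<Sum>j\<in>UNIV. \<Sum>h\<in>channels N. \<Sum>r\<in>rates N j h. \<beta> j h r * pmf \<mu> h * real (r m u)))"
    using assms by (intro sum_mono mult_left_mono) (auto simp: lp_feasible_def)
  also have "\<dots> = (\<Sum>j\<in>UNIV. \<Sum>h\<in>channels N. \<Sum>r\<in>rates N j h. \<Sum>m\<in>UNIV. \<Sum>u\<in>UNIV.
      \<beta> j h r * pmf \<mu> h * (real (q m u) * real (r m u)))"
    unfolding sum_weighted_swap by (simp add: mult_ac)
  also have "\<dots> = (\<Sum>j\<in>UNIV. \<Sum>h\<in>channels N. \<Sum>r\<in>rates N j h. \<beta> j h r * pmf \<mu> h * real (weight q r))"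
    by (simp add: real_weight sum_distrib_left)
  also have "\<dots> \<le> (\<Sum>j\<in>UNIV. \<Sum>h\<in>channels N. \<Sum>r\<in>rates N j h. \<beta> j h r * pmf \<mu> h * max_weight q j h)"
    using assms by (intro sum_mono mult_left_mono weight_le_max_weight) (auto simp: lp_feasible_def)
  also have "\<dots> = (\<Sum>j\<in>UNIV. \<Sum>h\<in>channels N. pmf \<sigma> j * pmf \<mu> h * max_weight q j h)"
    using assms by (intro sum.cong refl) (auto simp: lp_feasible_def sum_distrib_right)
  also have "\<dots> = measure_pmf.expectation \<sigma> (mean_max_weight q)"
    by (simp add: expectation_finite_type mean_max_weight_def sum_distrib_left mult_ac)
  finally show ?thesis .
qed

text \<open>The quadratic drift under an activation set \<open>i\<close> involves \<open>mean_max_weight q i\<close>, while the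
  program only controls its average over \<open>\<sigma>\<close>.  The correction \<open>- c * mean_max_weight q i\<close> solves the
  Poisson equation of the lazy activation chain: with \<open>c = 2 * (1 - \<epsilon>) / \<epsilon>\<close> it replaces the
  current value by that average, at a bounded price as it is Lipschitz in \<open>q\<close>.\<close>

lemma static_split_max_weight_stable:
  assumes \<phi>: "feasible_rates \<phi>"
    and act: "\<And>i q. activate \<phi> (i, q) = do { b \<leftarrow> bernoulli_pmf \<epsilon>; if b then \<sigma> else return_pmf i }"
    and alloc: "\<And>i q j h r. h \<in> channels N \<Longrightarrow> r \<in> set_pmf (allocate \<phi> (i, q) j h) \<Longrightarrow>
      is_arg_max (weight q) (\<lambda>r. r \<in> rates N j h) r"
    and \<epsilon>: "0 < \<epsilon>" "\<epsilon> < 1" and e: "0 < e"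
    and feas: "lp_feasible N \<mu> (\<lambda>m u. lam m u + e) (\<sigma>, \<beta>)"
  shows "network_stable P \<phi>"
proof -
  define c where "c = 2 * (1 - \<epsilon>) / \<epsilon>"
  \<comment> \<open>After one transition the new activation carries the factor \<open>2\<close> from
    service and \<open>c\<close> from the correction. Averaging over the lazy step leaves
    \<open>2\<close> on the mean over \<open>\<sigma>\<close> and \<open>c\<close> on the old
    activation, which is exactly the correction contained in \<open>V s\<close>.\<close>
  have c: "0 \<le> c" "(2 + c) * \<epsilon> = 2" "(2 + c) * (1 - \<epsilon>) = c"
    using \<epsilon> by (auto simp: c_def field_simps)
  let ?R = "real (max_rate N)"
  define sq :: "('m, 'u) vec \<Rightarrow> real" where "sq q = (\<Sum>m\<in>UNIV. \<Sum>u\<in>UNIV. (real (q m u))\<^sup>2)" for q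
  define V :: "('m, 'u) state \<Rightarrow> real" where "V = (\<lambda>(i, q). sq q - c * mean_max_weight q i)"
  define D where "D = real CARD('m) * real CARD('u) * (real (Abar + max_rate N))\<^sup>2"
  define E where "E = real CARD('m) * real CARD('u) * ?R\<^sup>2"
  \<comment> \<open>\<open>D\<close> bounds the second-order queue terms and \<open>c * E\<close>
    pays for the Lipschitz estimate; the \<open>1\<close> makes \<open>B\<close> positive for the
    occupation lemma.\<close>
  define B where "B = D + c * E + 1"
  have B: "0 < B" using c(1) by (simp add: B_def D_def E_def add_nonneg_pos)
  have drift: "measure_pmf.expectation (step P \<phi> s) V \<le> V s - 2 * e * queue_total (snd s) + B" for s
  proof -
    obtain i q where s: "s = (i, q)" by (cases s)
    \<comment> \<open>Both weight terms are evaluated at the old queues \<open>q\<close>, so that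
      the slot average produces the same function \<open>mean_max_weight q\<close> twice and the
      terms can be merged.\<close>
    let ?G = "\<lambda>j (a :: ('m, 'u) vec) h (r :: ('m, 'u) vec). sq q + 2 * (\<Sum>m\<in>UNIV. \<Sum>u\<in>UNIV. real (q m u) * real (a m u)) -
      2 * max_weight q j h - c * mean_max_weight q j + (B - 1)"
    have inner: "measure_pmf.expectation P (\<lambda>(a, h). measure_pmf.expectation (allocate \<phi> s j h) (?G j a h)) =
        sq q + 2 * (\<Sum>m\<in>UNIV. \<Sum>u\<in>UNIV. real (q m u) * lam m u) + (B - 1) - (2 + c) * mean_max_weight q j" for j
    proof -
      have "measure_pmf.expectation P (\<lambda>(a, h). \<Sum>m\<in>UNIV. \<Sum>u\<in>UNIV. real (q m u) * real (a m u)) =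
          (\<Sum>m\<in>UNIV. \<Sum>u\<in>UNIV. real (q m u) * lam m u)"
        by (simp add: case_prod_unfold integrable_slot Bochner_Integration.integral_sum
            mean_arrival[unfolded case_prod_unfold])
      moreover have "measure_pmf.expectation P (\<lambda>(a, h). max_weight q j h) = mean_max_weight q j"
        by (simp add: expectation_channel mean_max_weight_def)
      ultimately show ?thesis
        by (simp add: case_prod_unfold integrable_slot algebra_simps)
    qed
    have "measure_pmf.expectation (step P \<phi> s) V \<le>
      measure_pmf.expectation (activate \<phi> s) (\<lambda>j. measure_pmf.expectation P (\<lambda>(a, h).
        measure_pmf.expectation (allocate \<phi> s j h) (?G j a h)))"
    proof (rule expectation_step_le[OF \<phi>])
      fix j a h r assume ah: "(a, h) \<in> set_pmf P" and r: "r \<in> set_pmf (allocate \<phi> s j h)"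
      note h = slot_channel[OF ah]
      have rr: "r \<in> rates N j h" using set_pmf_allocate[OF \<phi> h] r by blast
      let ?q' = "\<lambda>m u. (snd s m u + a m u) - r m u"
      have "sq ?q' \<le> (\<Sum>m\<in>UNIV. \<Sum>u\<in>UNIV. (real (q m u))\<^sup>2 + 2 * (real (q m u) * real (a m u)) -
          2 * (real (q m u) * real (r m u)) + (real (Abar + max_rate N))\<^sup>2)"
        unfolding sq_def s snd_conv
        by (intro sum_mono queue_square_le slot_arrival_le[OF ah] rates_le[OF h rr])
      also have "\<dots> = sq q + 2 * (\<Sum>m\<in>UNIV. \<Sum>u\<in>UNIV. real (q m u) * real (a m u)) -
          2 * real (weight q r) + D"
        by (simp add: sq_def real_weight D_def sum.distrib sum_subtractf sum_distrib_left)
      also have "real (weight q r) = max_weight q j h"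
        by (rule is_arg_max_weight[OF h alloc[OF h r[unfolded s]]])
      finally have "sq ?q' \<le> sq q + 2 * (\<Sum>m\<in>UNIV. \<Sum>u\<in>UNIV. real (q m u) * real (a m u)) -
          2 * max_weight q j h + D" .
      moreover have "mean_max_weight q j \<le> mean_max_weight ?q' j + E"
        unfolding E_def
      proof (rule mean_max_weight_lipschitz)
        show "q m u \<le> ?q' m u + max_rate N" for m u
          using rates_le[OF h rr, of m u] by (simp add: s)
      qed
      from mult_left_mono[OF this c(1)]
      have "c * mean_max_weight q j \<le> c * mean_max_weight ?q' j + c * E"
        by (simp only: distrib_left)
      ultimately show "V (j, ?q') \<le> ?G j a h r"
        by (simp add: V_def B_def)
    qed
    also have "\<dots> = measure_pmf.expectation (activate \<phi> s) (\<lambda>j. sq q +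
          2 * (\<Sum>m\<in>UNIV. \<Sum>u\<in>UNIV. real (q m u) * lam m u) + (B - 1) - (2 + c) * mean_max_weight q j)"
      by (simp only: inner)
    also have "\<dots> =
        sq q + 2 * (\<Sum>m\<in>UNIV. \<Sum>u\<in>UNIV. real (q m u) * lam m u) + (B - 1) -
        (2 + c) * measure_pmf.expectation (activate \<phi> s) (mean_max_weight q)"
      by (simp add: integrable_measure_pmf_finite)
    also have "(2 + c) * measure_pmf.expectation (activate \<phi> s) (mean_max_weight q) =
        (2 + c) * \<epsilon> * measure_pmf.expectation \<sigma> (mean_max_weight q) + (2 + c) * (1 - \<epsilon>) * mean_max_weight q i"
      unfolding s act using \<epsilon> by (subst expectation_static_split) (auto simp: algebra_simps)
    also have "\<dots> = 2 * measure_pmf.expectation \<sigma> (mean_max_weight q) + c * mean_max_weight q i"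
      by (simp only: c)
    finally have "measure_pmf.expectation (step P \<phi> s) V \<le> V s + B +
        2 * (\<Sum>m\<in>UNIV. \<Sum>u\<in>UNIV. real (q m u) * lam m u) - 2 * measure_pmf.expectation \<sigma> (mean_max_weight q)"
      by (simp add: V_def s)
    moreover have "(\<Sum>m\<in>UNIV. \<Sum>u\<in>UNIV. real (q m u) * lam m u) + e * queue_total q \<le>
        measure_pmf.expectation \<sigma> (mean_max_weight q)"
      using lp_feasible_max_weight[OF feas, of q]
      by (simp add: queue_total_def distrib_left sum.distrib sum_distrib_left mult_ac)
    ultimately show ?thesis by (simp add: s)
  qed
  have below: "- (real CARD('m) * real CARD('u) * (c * ?R)\<^sup>2) \<le> V s" for s
  proof -
    obtain i q where s: "s = (i, q)" by (cases s)
    have "- (real CARD('m) * real CARD('u) * (c * ?R)\<^sup>2) = (\<Sum>m\<in>(UNIV::'m set). \<Sum>u\<in>(UNIV::'u set). - (c * ?R)\<^sup>2)"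
      by simp
    also have "\<dots> \<le> (\<Sum>m\<in>UNIV. \<Sum>u\<in>UNIV. (real (q m u))\<^sup>2 - c * ?R * real (q m u))"
    proof (intro sum_mono)
      fix m u
      \<comment> \<open>Completing the square gives a lower bound with one quarter of the square of
        \<open>c * ?R\<close>; the other three quarters are slack for a rounder constant.\<close>
      have "0 \<le> (real (q m u) - c * ?R / 2)\<^sup>2 + 3 / 4 * (c * ?R)\<^sup>2" by simp
      also have "\<dots> = (real (q m u))\<^sup>2 - c * ?R * real (q m u) + (c * ?R)\<^sup>2"
        by (simp add: power2_eq_square field_simps)
      finally show "- (c * ?R)\<^sup>2 \<le> (real (q m u))\<^sup>2 - c * ?R * real (q m u)" by simp
    qed
    also have "\<dots> = sq q - c * (?R * queue_total q)"
      by (simp add: sq_def queue_total_def sum_subtractf sum_distrib_left mult_ac)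
    also have "\<dots> \<le> V s"
      using mult_left_mono[OF mean_max_weight_le c(1)] by (simp add: V_def s)
    finally show ?thesis .
  qed
  show ?thesis
    unfolding network_stable_def
  proof (intro exI conjI allI)
    \<comment> \<open>The level \<open>B / e\<close> is where \<open>2 * e * queue_total\<close>
      reaches \<open>2 * B\<close>. Any fraction below one half would do, as stability asks for a
      strict inequality.\<close>
    show "0 < B / e" "0 < 1 / (4 :: real)" using B e by simp_all
    fix s\<^sub>0
    have "{s :: ('m, 'u) state. (\<Sum>m\<in>UNIV. \<Sum>u\<in>UNIV. real (snd s m u)) \<le> B / e} =
        {s. 2 * e * queue_total (snd s) \<le> 2 * B}"
      using e by (simp add: queue_total_def pos_le_divide_eq mult_ac)
    moreover have "1 / 2 \<le> liminf (\<lambda>T. ereal (1 / real T *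
        (\<Sum>k<T. measure_pmf.prob (iterate_kernel (step P \<phi>) k s\<^sub>0) {s. 2 * e * queue_total (snd s) \<le> 2 * B})))"
      using e by (intro foster_lyapunov_occupation[OF finite_set_pmf_step[OF \<phi>] drift below _ B])
        (simp add: queue_total_def sum_nonneg)
    moreover have "ereal (1 / 4) < 1 / 2" by (simp add: numeral_eq_ereal one_ereal_def)
    ultimately show "ereal (1 / 4) < liminf (\<lambda>T. ereal (1 / real T *
        (\<Sum>t = 1..T. measure_pmf.prob (state_at P \<phi> s\<^sub>0 t)
           {s. (\<Sum>m\<in>UNIV. \<Sum>u\<in>UNIV. real (snd s m u)) \<le> B / e})))"
      unfolding One_nat_def sum.atLeast1_atMost_eq by (simp add: state_at_def)
  qed
qed

section \<open>Cost and stability for a fixed slot law\<close>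

lemma static_split_max_weight_bounds:
  assumes rule: "static_split_max_weight N \<mu> (\<lambda>m u. lam m u + e) \<epsilon> \<phi>"
    and e: "0 < e" and \<epsilon>: "0 < \<epsilon>" "\<epsilon> < 1"
    and e1: "0 < e1" and x1: "lp_feasible N \<mu> (\<lambda>m u. lam m u + e1) x1"
  shows "network_cost N P \<phi> s \<le> optimal_cost N P s +
      ereal (switch_cost N * real CARD('m) * \<epsilon> + active_cost N * real CARD('m) / e1 * e)"
    and "network_stable P \<phi>"
proof -
  obtain \<sigma> \<beta> where opt: "lp_optimal N (activation_objective N) \<mu> (\<lambda>m u. lam m u + e) (\<sigma>, \<beta>)"
    and act: "\<And>i q. activate \<phi> (i, q) = do { b \<leftarrow> bernoulli_pmf \<epsilon>; if b then \<sigma> else return_pmf i }"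
    and alloc: "\<And>i q j h r. h \<in> channels N \<Longrightarrow> r \<in> set_pmf (allocate \<phi> (i, q) j h) \<Longrightarrow>
      is_arg_max (weight q) (\<lambda>r. r \<in> rates N j h) r"
    using rule unfolding static_split_max_weight_def by blast
  have \<phi>: "feasible_rates \<phi>"
    unfolding feasible_rates_def using alloc by (auto simp: is_arg_max_def)
  have feas: "lp_feasible N \<mu> (\<lambda>m u. lam m u + e) (\<sigma>, \<beta>)"
    using opt by (simp add: lp_optimal_def is_arg_min_def)
  show "network_stable P \<phi>"
    by (rule static_split_max_weight_stable[OF \<phi> act alloc \<epsilon> e feas])
  let ?g = "active_cost N * real CARD('m) / e1 * e"
  let ?A = "switch_cost N * real CARD('m) * \<epsilon>"
  let ?o = "lp_objective N (activation_objective N) (\<sigma>, \<beta>)"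
  have "ereal (?o - ?g) \<le> optimal_cost N P s"
    unfolding optimal_cost_def
  proof (rule INF_greatest)
    fix \<psi> assume "\<psi> \<in> {\<phi> \<in> ergodic_policies N P. network_stable P \<phi>}"
    then obtain x where x: "lp_feasible N \<mu> lam x"
      "ereal (lp_objective N (activation_objective N) x) \<le> network_cost N P \<psi> s"
      using ergodic_lp_bound by blast
    have "?o - ?g \<le> lp_objective N (activation_objective N) x"
      using lp_optimum_sensitivity[OF x(1) e1 x1 e opt] by simp
    with x(2) show "ereal (?o - ?g) \<le> network_cost N P \<psi> s"
      by (meson ereal_less_eq(3) order_trans)
  qed
  \<comment> \<open>\<open>optimal_cost\<close> is an infimum in \<open>ereal\<close> and is
    infinite over an empty set of policies, so a finite amount is added to both sides and nothing
    infinite is subtracted.\<close>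
  then have "ereal (?o - ?g) + ereal (?A + ?g) \<le> optimal_cost N P s + ereal (?A + ?g)"
    by (rule add_right_mono)
  moreover have "ereal (?o - ?g) + ereal (?A + ?g) = ereal (?A + ?o)" by simp
  ultimately have "ereal (?A + ?o) \<le> optimal_cost N P s + ereal (?A + ?g)"
    by (simp only:)
  with static_split_cost[OF \<phi> act \<epsilon>]
  show "network_cost N P \<phi> s \<le> optimal_cost N P s + ereal (?A + ?g)"
    by (rule order_trans)
qed

end

theorem theorem2:
  shows "\<exists>\<kappa> :: nat \<Rightarrow> nat \<Rightarrow> nat \<Rightarrow> real \<Rightarrow> real \<Rightarrow> real.
    \<forall>N :: ('m::finite, 'c, 'u::finite) network. wf_network N \<longrightarrow>
    (\<forall>(\<mu> :: ('m \<Rightarrow> 'c) pmf) (lam :: 'm \<Rightarrow> 'u \<Rightarrow> real).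
      \<exists>\<gamma> :: real \<Rightarrow> real. strict_mono_on {0<..} \<gamma> \<and> (\<gamma> \<longlongrightarrow> 0) (at_right 0) \<and>
      (\<forall>Abar P \<epsilon>\<^sub>g \<epsilon>\<^sub>s \<phi>.
         slot_law N Abar \<mu> lam P \<longrightarrow>
         0 < \<epsilon>\<^sub>g \<longrightarrow> (\<mu>, \<lambda>m u. lam m u + 2 * \<epsilon>\<^sub>g) \<in> supportable N \<longrightarrow>
         0 < \<epsilon>\<^sub>s \<longrightarrow> \<epsilon>\<^sub>s < 1 \<longrightarrow>
         static_split_max_weight N \<mu> (\<lambda>m u. lam m u + \<epsilon>\<^sub>g) \<epsilon>\<^sub>s \<phi> \<longrightarrow>
         (\<forall>s\<^sub>0. network_cost N P \<phi> s\<^sub>0 \<le> optimal_cost N P s\<^sub>0 +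
            ereal (\<kappa> CARD('m) CARD('u) (card (channels N)) (switch_cost N) (active_cost N) * \<epsilon>\<^sub>s
                   + \<gamma> \<epsilon>\<^sub>g)) \<and>
         network_stable P \<phi>))"
proof (intro exI[of _ "\<lambda>M _ _ c\<^sub>0 _. c\<^sub>0 * real M"] allI impI)
  fix N :: "('m, 'c, 'u) network" and \<mu> :: "('m \<Rightarrow> 'c) pmf" and lam :: "'m \<Rightarrow> 'u \<Rightarrow> real"
  assume wf: "wf_network N"
  \<comment> \<open>\<gamma> has to be fixed before the slot law, \<open>\<epsilon>\<^sub>g\<close>
    and the policy. Its slope therefore uses one margin \<open>e1\<close> chosen from \<mu> and
    \<open>lam\<close> alone.\<close>
  define F where "F e x \<longleftrightarrow> 0 < e \<and> lp_feasible N \<mu> (\<lambda>m u. lam m u + e) x" for e x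
  define e1 where "e1 = (SOME e. \<exists>x. F e x)"
  define G where "G = active_cost N * real CARD('m) / e1"
  \<comment> \<open>If no margin is feasible, \<open>e1\<close> is arbitrary and \<open>G\<close>
    may be negative; if activation is free, \<open>G\<close> is 0. The factor is positive in every
    case, as strict monotonicity requires.\<close>
  define \<gamma> where "\<gamma> e = (max G 0 + 1) * e" for e
  have mono: "strict_mono_on {0<..} \<gamma>"
    by (rule strict_mono_onI) (auto simp: \<gamma>_def intro!: mult_strict_left_mono)
  have lim: "(\<gamma> \<longlongrightarrow> 0) (at_right 0)"
    unfolding \<gamma>_def by (auto intro!: tendsto_eq_intros)
  have bound: "(\<forall>s. network_cost N P \<phi> s \<le> optimal_cost N P s +
      ereal (switch_cost N * real CARD('m) * \<epsilon> + \<gamma> e)) \<and> network_stable P \<phi>"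
    if law: "slot_law N Abar \<mu> lam P" and e: "0 < e" and \<epsilon>: "0 < \<epsilon>" "\<epsilon> < 1"
      and rule: "static_split_max_weight N \<mu> (\<lambda>m u. lam m u + e) \<epsilon> \<phi>" for Abar P e \<epsilon> \<phi>
  proof -
    interpret slotted_network N Abar \<mu> lam P
      by unfold_locales (rule wf, rule law)
    \<comment> \<open>An instance of the rule carries an optimal, hence feasible, point at
      \<open>lam + e\<close>; this makes the choice of \<open>e1\<close> meaningful.\<close>
    have "\<exists>x. F e x"
      using rule e by (auto simp: static_split_max_weight_def lp_optimal_def is_arg_min_def F_def)
    then have "\<exists>x. F e1 x" unfolding e1_def by (rule someI)
    then obtain x1 where e1: "0 < e1" and x1: "lp_feasible N \<mu> (\<lambda>m u. lam m u + e1) x1"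
      by (auto simp: F_def)
    note bounds = static_split_max_weight_bounds[OF rule e \<epsilon> e1 x1]
    have "G * e \<le> \<gamma> e"
      unfolding \<gamma>_def using e by (intro mult_right_mono) auto
    then have "ereal (switch_cost N * real CARD('m) * \<epsilon> + G * e) \<le>
        ereal (switch_cost N * real CARD('m) * \<epsilon> + \<gamma> e)" by simp
    then show ?thesis
      using bounds(2) order_trans[OF bounds(1) add_left_mono] by (simp only: G_def simp_thms)
  qed
  show "\<exists>\<gamma>. strict_mono_on {0<..} \<gamma> \<and> (\<gamma> \<longlongrightarrow> 0) (at_right 0) \<and>
      (\<forall>Abar P \<epsilon>\<^sub>g \<epsilon>\<^sub>s \<phi>. slot_law N Abar \<mu> lam P \<longrightarrow>
         0 < \<epsilon>\<^sub>g \<longrightarrow> (\<mu>, \<lambda>m u. lam m u + 2 * \<epsilon>\<^sub>g) \<in> supportable N \<longrightarrow>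
         0 < \<epsilon>\<^sub>s \<longrightarrow> \<epsilon>\<^sub>s < 1 \<longrightarrow>
         static_split_max_weight N \<mu> (\<lambda>m u. lam m u + \<epsilon>\<^sub>g) \<epsilon>\<^sub>s \<phi> \<longrightarrow>
         (\<forall>s\<^sub>0. network_cost N P \<phi> s\<^sub>0 \<le> optimal_cost N P s\<^sub>0 +
            ereal (switch_cost N * real CARD('m) * \<epsilon>\<^sub>s + \<gamma> \<epsilon>\<^sub>g)) \<and>
         network_stable P \<phi>)"
    by (intro exI[of _ \<gamma>] conjI mono lim allI[where 'a = nat] allI[where 'a = real] allI impI)
      (blast dest: bound)+
qed

end
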